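(* Let $\Sigma=(A,G,\alpha,\sigma)$ be a twisted unital discrete C$^*$-dynamical system. Assume that $\Sigma$ is exact and has property (DP). Then the map $J\mapsto\langle J\rangle$ is a bijection between the set $\mathcal{MI}(A)$ of maximal invariant ideals of $A$ and the set $\mathcal{M}(C_r^*(\Sigma))$ of maximal ideals of $C_r^*(\Sigma)$. Thus, the family of all simple quotients of $C_r^*(\Sigma)$ is given by $\{C_r^*(\Sigma/J)\}_{J\in\mathcal{MI}(A)}$.
   Context: Conventions: an ideal of a C$^*$-algebra always means a closed two-sided ideal. A twisted unital discrete C$^*$-dynamical system $\Sigma=(A,G,\alpha,\sigma)$ consists of a unital C$^*$-algebra $A$, a discrete group $G$ with identity $e$, and maps $\alpha:G\to\mathrm{Aut}(A)$, $\sigma:G\times G\to\mathcal{U}(A)$ (the unitary group of $A$) such that for all $g,h,k\in G$: $\alpha_g\circ\alpha_h=\mathrm{Ad}(\sigma(g,h))\circ\alpha_{gh}$, $\sigma(g,h)\sigma(gh,k)=\alpha_g(\sigma(h,k))\sigma(g,hk)$, $\sigma(g,e)=\sigma(e,g)=1$. The reduced crossed product $C_r^*(\Sigma)$ is characterized up to isomorphism as follows: it is a C$^*$-algebra generated by (a copy of) $A$ and unitaries $\{\lambda(g)\mid g\in G\}$ with $\alpha_g(a)=\lambda(g)a\lambda(g)^*$ and $\lambda(g)\lambda(h)=\sigma(g,h)\lambda(gh)$ for all $g,h\in G$, $a\in A$, and there is a faithful conditional expectation $E:C_r^*(\Sigma)\to A$ with $E(\lambda(g))=0$ for all $g\ne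 e$. Property (DP): $\Sigma$ has property (DP) if for every $y\in C_r^*(\Sigma)$ with $y^*=y$ and $E(y)=0$, the element $0$ belongs to the norm closure of the convex hull of $\{vyv^*\mid v\in\mathcal{U}(C_r^*(\Sigma))\}$. An ideal $J$ of $A$ is invariant if $\alpha_g(J)=J$ for all $g\in G$. For such $J$, $\Sigma/J=(A/J,G,\dot\alpha,\dot\sigma)$ denotes the quotient system, $(\dot\alpha,\dot\sigma)$ being the twisted action on $A/J$ induced by $(\alpha,\sigma)$; $\langle J\rangle$ denotes the ideal of $C_r^*(\Sigma)$ generated by $J$; and $\tilde J$ denotes the kernel of the canonical $*$-homomorphism of $C_r^*(\Sigma)$ onto $C_r^*(\Sigma/J)$ (sending $a$ to $a+J$ and $\lambda(g)$ to the corresponding unitary of $C_r^*(\Sigma/J)$). $\Sigma$ is called exact if $\langle J\rangle=\tilde J$ for every invariant ideal $J$ of $A$. A maximal invariant ideal of $A$ is an element that is maximal among the proper invariant ideals of $A$; a maximal ideal of $C_r^*(\Sigma)$ is one that is maximal among its proper ideals. Simple quotients are understood up to canonical isomorphism. *)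

theory Defs
  imports "HOL-Algebra.Algebra" "HOL-Analysis.Abstract_Metric_Spaces"
begin

no_notation eq_closure_of (\<open>closure'_of\<index>\<close>)

section \<open>Unital C*-algebras on explicit carriers\<close>

text \<open>
  Quotients by varying ideals have to be C*-algebras again, so C*-algebras are carrier-based
  records extending the rings and modules of HOL-Algebra.  The zero algebra is allowed: it is
  the quotient of an algebra by itself.
\<close>

record 'a cstar = "(complex, 'a) module" +
  star :: "'a \<Rightarrow> 'a"
  nrm :: "'a \<Rightarrow> real"

definition complex_field :: "complex ring"
  where "complex_field = \<lparr>carrier = UNIV, monoid.mult = (*), monoid.one = 1, ring.zero = 0, ring.add = (+)\<rparr>"

text \<open>
  The locale \<open>Metric_space\<close> wants nonnegativity and symmetry also off the carrier,
  where the record operations are unconstrained; hence the guard.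
\<close>

definition cstar_dist :: "('a, 'm) cstar_scheme \<Rightarrow> 'a \<Rightarrow> 'a \<Rightarrow> real"
  where "cstar_dist A x y =
    (if x \<in> carrier A \<and> y \<in> carrier A then nrm A (x \<ominus>\<^bsub>A\<^esub> y) else 0)"

abbreviation cstar_topology :: "('a, 'm) cstar_scheme \<Rightarrow> 'a topology"
  where "cstar_topology A \<equiv> Metric_space.mtopology (carrier A) (cstar_dist A)"

locale unital_cstar_algebra =
  ring A + Module.module complex_field A for A :: "('a, 'm) cstar_scheme" (structure) +
  assumes smult_mult_left:
      "\<lbrakk>x \<in> carrier A; y \<in> carrier A\<rbrakk> \<Longrightarrow> (c \<odot> x) \<otimes> y = c \<odot> (x \<otimes> y)"
    and smult_mult_right:
      "\<lbrakk>x \<in> carrier A; y \<in> carrier A\<rbrakk> \<Longrightarrow> x \<otimes> (c \<odot> y) = c \<odot> (x \<otimes> y)"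
    and star_closed: "x \<in> carrier A \<Longrightarrow> star A x \<in> carrier A"
    and star_star: "x \<in> carrier A \<Longrightarrow> star A (star A x) = x"
    and star_add:
      "\<lbrakk>x \<in> carrier A; y \<in> carrier A\<rbrakk> \<Longrightarrow> star A (x \<oplus> y) = star A x \<oplus> star A y"
    and star_mult:
      "\<lbrakk>x \<in> carrier A; y \<in> carrier A\<rbrakk> \<Longrightarrow> star A (x \<otimes> y) = star A y \<otimes> star A x"
    and star_smult: "x \<in> carrier A \<Longrightarrow> star A (c \<odot> x) = cnj c \<odot> star A x"
    and norm_nonneg: "x \<in> carrier A \<Longrightarrow> 0 \<le> nrm A x"
    and norm_eq_zero: "x \<in> carrier A \<Longrightarrow> nrm A x = 0 \<longleftrightarrow> x = \<zero>"
    and norm_triangle: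
      "\<lbrakk>x \<in> carrier A; y \<in> carrier A\<rbrakk> \<Longrightarrow> nrm A (x \<oplus> y) \<le> nrm A x + nrm A y"
    and norm_smult: "x \<in> carrier A \<Longrightarrow> nrm A (c \<odot> x) = cmod c * nrm A x"
    and norm_mult:
      "\<lbrakk>x \<in> carrier A; y \<in> carrier A\<rbrakk> \<Longrightarrow> nrm A (x \<otimes> y) \<le> nrm A x * nrm A y"
    and cstar_identity: "x \<in> carrier A \<Longrightarrow> nrm A (star A x \<otimes> x) = (nrm A x)\<^sup>2"
    and complete: "Metric_space.mcomplete (carrier A) (cstar_dist A)"

definition unitaries :: "('a, 'm) cstar_scheme \<Rightarrow> 'a set"
  where "unitaries A = {u \<in> carrier A. star A u \<otimes>\<^bsub>A\<^esub> u = \<one>\<^bsub>A\<^esub> \<and> u \<otimes>\<^bsub>A\<^esub> star A u = \<one>\<^bsub>A\<^esub>}"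

definition positive_elements :: "('a, 'm) cstar_scheme \<Rightarrow> 'a set"
  where "positive_elements A = {star A b \<otimes>\<^bsub>A\<^esub> b | b. b \<in> carrier A}"

definition cstar_convex_hull :: "('a, 'm) cstar_scheme \<Rightarrow> 'a set \<Rightarrow> 'a set"
  where "cstar_convex_hull A Y =
    {\<Oplus>\<^bsub>A\<^esub>i\<in>{..<n}. complex_of_real (t i) \<odot>\<^bsub>A\<^esub> x i | (n :: nat) t x.
       (\<forall>i<n. 0 \<le> t i \<and> x i \<in> Y) \<and> (\<Sum>i<n. t i) = 1}"

subsection \<open>Homomorphisms and generated subalgebras\<close>

definition star_hom :: "('a, 'm) cstar_scheme \<Rightarrow> ('b, 'n) cstar_scheme \<Rightarrow> ('a \<Rightarrow> 'b) set"
  where "star_hom A B = {\<phi> \<in> ring_hom A B. \<forall>x \<in> carrier A.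
    (\<forall>c. \<phi> (c \<odot>\<^bsub>A\<^esub> x) = c \<odot>\<^bsub>B\<^esub> \<phi> x) \<and> \<phi> (star A x) = star B (\<phi> x)}"

definition star_iso :: "('a, 'm) cstar_scheme \<Rightarrow> ('b, 'n) cstar_scheme \<Rightarrow> ('a \<Rightarrow> 'b) set"
  where "star_iso A B = {\<phi> \<in> star_hom A B. bij_betw \<phi> (carrier A) (carrier B)}"

definition cstar_subalgebra :: "'a set \<Rightarrow> ('a, 'm) cstar_scheme \<Rightarrow> bool"
  where "cstar_subalgebra T A \<longleftrightarrow> subring T A \<and>
    (\<forall>x\<in>T. star A x \<in> T \<and> (\<forall>c. c \<odot>\<^bsub>A\<^esub> x \<in> T)) \<and> closedin (cstar_topology A) T"

definition cstar_generated :: "('a, 'm) cstar_scheme \<Rightarrow> 'a set \<Rightarrow> 'a set"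
  where "cstar_generated A Y = \<Inter> {T. cstar_subalgebra T A \<and> Y \<subseteq> T}"

subsection \<open>Closed ideals, quotients, simplicity\<close>

definition closed_ideal :: "'a set \<Rightarrow> ('a, 'm) cstar_scheme \<Rightarrow> bool"
  where "closed_ideal J A \<longleftrightarrow> ideal J A \<and> closedin (cstar_topology A) J"

definition closed_genideal :: "('a, 'm) cstar_scheme \<Rightarrow> 'a set \<Rightarrow> 'a set"
  where "closed_genideal A Y = \<Inter> {K. closed_ideal K A \<and> Y \<subseteq> K}"

definition maximal_ideals :: "('a, 'm) cstar_scheme \<Rightarrow> 'a set set"
  where "maximal_ideals A = {M. closed_ideal M A \<and> M \<noteq> carrier A \<and>
    (\<forall>K. closed_ideal K A \<and> K \<noteq> carrier A \<and> M \<subseteq> K \<longrightarrow> K = M)}"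

definition cstar_simple :: "('a, 'm) cstar_scheme \<Rightarrow> bool"
  where "cstar_simple A \<longleftrightarrow> carrier A \<noteq> {\<zero>\<^bsub>A\<^esub>} \<and>
    (\<forall>K. closed_ideal K A \<longrightarrow> K = {\<zero>\<^bsub>A\<^esub>} \<or> K = carrier A)"

definition cstar_quot :: "('a, 'm) cstar_scheme \<Rightarrow> 'a set \<Rightarrow> 'a set cstar"
  where "cstar_quot A J =
    \<lparr>carrier = carrier (A Quot J), monoid.mult = monoid.mult (A Quot J), monoid.one = monoid.one (A Quot J),
     ring.zero = ring.zero (A Quot J), ring.add = ring.add (A Quot J),
     smult = (\<lambda>c Y. \<Union>x\<in>Y. J +>\<^bsub>A\<^esub> (c \<odot>\<^bsub>A\<^esub> x)),
     star = (\<lambda>Y. \<Union>x\<in>Y. J +>\<^bsub>A\<^esub> star A x),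
     nrm = (\<lambda>Y. Inf (nrm A ` Y))\<rparr>"

section \<open>Twisted unital discrete C*-dynamical systems\<close>

record ('a, 'g) tsystem =
  alg :: "'a cstar"
  grp :: "'g monoid"
  act :: "'g \<Rightarrow> 'a \<Rightarrow> 'a"
  cocycle :: "'g \<Rightarrow> 'g \<Rightarrow> 'a"

locale twisted_system =
  base: unital_cstar_algebra "alg S" + grp: group "grp S" for S :: "('a, 'g) tsystem" +
  assumes act_aut: "g \<in> carrier (grp S) \<Longrightarrow> act S g \<in> star_iso (alg S) (alg S)"
    and cocycle_unitary:
      "\<lbrakk>g \<in> carrier (grp S); h \<in> carrier (grp S)\<rbrakk> \<Longrightarrow> cocycle S g h \<in> unitaries (alg S)"
    and act_act:
      "\<lbrakk>g \<in> carrier (grp S); h \<in> carrier (grp S); a \<in> carrier (alg S)\<rbrakk> \<Longrightarrow>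
        act S g (act S h a) =
          cocycle S g h \<otimes>\<^bsub>alg S\<^esub> act S (g \<otimes>\<^bsub>grp S\<^esub> h) a \<otimes>\<^bsub>alg S\<^esub> star (alg S) (cocycle S g h)"
    and cocycle_identity:
      "\<lbrakk>g \<in> carrier (grp S); h \<in> carrier (grp S); k \<in> carrier (grp S)\<rbrakk> \<Longrightarrow>
        cocycle S g h \<otimes>\<^bsub>alg S\<^esub> cocycle S (g \<otimes>\<^bsub>grp S\<^esub> h) k =
        act S g (cocycle S h k) \<otimes>\<^bsub>alg S\<^esub> cocycle S g (h \<otimes>\<^bsub>grp S\<^esub> k)"
    and cocycle_one:
      "g \<in> carrier (grp S) \<Longrightarrow>
        cocycle S g \<one>\<^bsub>grp S\<^esub> = \<one>\<^bsub>alg S\<^esub> \<and> cocycle S \<one>\<^bsub>grp S\<^esub> g = \<one>\<^bsub>alg S\<^esub>"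

definition invariant_ideal :: "('a, 'g) tsystem \<Rightarrow> 'a set \<Rightarrow> bool"
  where "invariant_ideal S J \<longleftrightarrow>
    closed_ideal J (alg S) \<and> (\<forall>g \<in> carrier (grp S). act S g ` J = J)"

definition maximal_invariant_ideals :: "('a, 'g) tsystem \<Rightarrow> 'a set set"
  where "maximal_invariant_ideals S = {J. invariant_ideal S J \<and> J \<noteq> carrier (alg S) \<and>
    (\<forall>K. invariant_ideal S K \<and> K \<noteq> carrier (alg S) \<and> J \<subseteq> K \<longrightarrow> K = J)}"

definition system_quot :: "('a, 'g) tsystem \<Rightarrow> 'a set \<Rightarrow> ('a set, 'g) tsystem"
  where "system_quot S J =
    \<lparr>alg = cstar_quot (alg S) J, grp = grp S,
     act = (\<lambda>g Y. \<Union>x\<in>Y. J +>\<^bsub>alg S\<^esub> act S g x),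
     cocycle = (\<lambda>g h. J +>\<^bsub>alg S\<^esub> cocycle S g h)\<rparr>"

section \<open>Reduced crossed products\<close>

text \<open>
  The reduced crossed product is only determined up to isomorphism.  The record holds one
  realization \<open>cp\<close> of it together with the embedding \<open>emb\<close> of the base algebra, the
  unitaries \<open>uni g\<close> and the conditional expectation \<open>expt\<close>, which takes values in the base
  algebra itself and not in its copy \<open>emb ` carrier A\<close>.
\<close>

record ('a, 'g, 'b) crossed_product =
  cp :: "'b cstar"
  emb :: "'a \<Rightarrow> 'b"
  uni :: "'g \<Rightarrow> 'b"
  expt :: "'b \<Rightarrow> 'a"

definition conditional_expectation ::
    "('a, 'm) cstar_scheme \<Rightarrow> ('b, 'n) cstar_scheme \<Rightarrow> ('a \<Rightarrow> 'b) \<Rightarrow> ('b \<Rightarrow> 'a) \<Rightarrow> bool"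
  where "conditional_expectation A B \<iota> E \<longleftrightarrow>
    E \<in> carrier B \<rightarrow> carrier A \<and>
    (\<forall>x\<in>carrier B. \<forall>y\<in>carrier B. E (x \<oplus>\<^bsub>B\<^esub> y) = E x \<oplus>\<^bsub>A\<^esub> E y) \<and>
    (\<forall>c. \<forall>x\<in>carrier B. E (c \<odot>\<^bsub>B\<^esub> x) = c \<odot>\<^bsub>A\<^esub> E x) \<and>
    (\<forall>x\<in>carrier B. nrm A (E x) \<le> nrm B x) \<and>
    E ` positive_elements B \<subseteq> positive_elements A \<and>
    (\<forall>a\<in>carrier A. E (\<iota> a) = a) \<and>
    (\<forall>a\<in>carrier A. \<forall>x\<in>carrier B.
       E (\<iota> a \<otimes>\<^bsub>B\<^esub> x) = a \<otimes>\<^bsub>A\<^esub> E x \<and> E (x \<otimes>\<^bsub>B\<^esub> \<iota> a) = E x \<otimes>\<^bsub>A\<^esub> a)"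

definition faithful_on_positives ::
    "('a, 'm) cstar_scheme \<Rightarrow> ('b, 'n) cstar_scheme \<Rightarrow> ('b \<Rightarrow> 'a) \<Rightarrow> bool"
  where "faithful_on_positives A B E \<longleftrightarrow>
    (\<forall>x\<in>positive_elements B. E x = \<zero>\<^bsub>A\<^esub> \<longrightarrow> x = \<zero>\<^bsub>B\<^esub>)"

locale reduced_crossed_product =
  sys: twisted_system S + crp: unital_cstar_algebra "cp P"
  for S :: "('a, 'g) tsystem" and P :: "('a, 'g, 'b) crossed_product" +
  assumes emb_hom: "emb P \<in> star_hom (alg S) (cp P)"
    and emb_inj: "inj_on (emb P) (carrier (alg S))"
    and uni_unitary: "g \<in> carrier (grp S) \<Longrightarrow> uni P g \<in> unitaries (cp P)"
    and covariance:
      "\<lbrakk>g \<in> carrier (grp S); a \<in> carrier (alg S)\<rbrakk> \<Longrightarrow>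
        emb P (act S g a) = uni P g \<otimes>\<^bsub>cp P\<^esub> emb P a \<otimes>\<^bsub>cp P\<^esub> star (cp P) (uni P g)"
    and uni_mult:
      "\<lbrakk>g \<in> carrier (grp S); h \<in> carrier (grp S)\<rbrakk> \<Longrightarrow>
        uni P g \<otimes>\<^bsub>cp P\<^esub> uni P h = emb P (cocycle S g h) \<otimes>\<^bsub>cp P\<^esub> uni P (g \<otimes>\<^bsub>grp S\<^esub> h)"
    and generated:
      "cstar_generated (cp P) (emb P ` carrier (alg S) \<union> uni P ` carrier (grp S)) = carrier (cp P)"
    and expt_expectation: "conditional_expectation (alg S) (cp P) (emb P) (expt P)"
    and expt_faithful: "faithful_on_positives (alg S) (cp P) (expt P)"
    and expt_uni: "\<lbrakk>g \<in> carrier (grp S); g \<noteq> \<one>\<^bsub>grp S\<^esub>\<rbrakk> \<Longrightarrow> expt P (uni P g) = \<zero>\<^bsub>alg S\<^esub>"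

definition unitary_orbit :: "('a, 'm) cstar_scheme \<Rightarrow> 'a \<Rightarrow> 'a set"
  where "unitary_orbit A y = (\<lambda>v. v \<otimes>\<^bsub>A\<^esub> y \<otimes>\<^bsub>A\<^esub> star A v) ` unitaries A"

definition property_DP :: "('a, 'g) tsystem \<Rightarrow> ('a, 'g, 'b) crossed_product \<Rightarrow> bool"
  where "property_DP S P \<longleftrightarrow>
    (\<forall>y \<in> carrier (cp P). star (cp P) y = y \<and> expt P y = \<zero>\<^bsub>alg S\<^esub> \<longrightarrow>
      \<zero>\<^bsub>cp P\<^esub> \<in>
        cstar_topology (cp P) closure_of cstar_convex_hull (cp P) (unitary_orbit (cp P) y))"

definition induced_ideal :: "('a, 'g, 'b) crossed_product \<Rightarrow> 'a set \<Rightarrow> 'b set"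
  where "induced_ideal P J = closed_genideal (cp P) (emb P ` J)"

text \<open>
  In the following, \<open>Q\<close> is a realization of the reduced crossed product of the quotient
  system by \<open>J\<close>.  A canonical homomorphism exists and is unique on the carrier: its values
  on the generators are prescribed and *-homomorphisms of C*-algebras are continuous.  So
  \<open>canonical_kernel\<close> is a definite description of the kernel of the canonical homomorphism.
\<close>

definition canonical_hom ::
    "('a, 'g) tsystem \<Rightarrow> 'a set \<Rightarrow> ('a, 'g, 'b) crossed_product \<Rightarrow>
      ('a set, 'g, 'c) crossed_product \<Rightarrow> ('b \<Rightarrow> 'c) \<Rightarrow> bool"
  where "canonical_hom S J P Q \<pi> \<longleftrightarrow>
    \<pi> \<in> star_hom (cp P) (cp Q) \<and> \<pi> ` carrier (cp P) = carrier (cp Q) \<and>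
    (\<forall>a \<in> carrier (alg S). \<pi> (emb P a) = emb Q (J +>\<^bsub>alg S\<^esub> a)) \<and>
    (\<forall>g \<in> carrier (grp S). \<pi> (uni P g) = uni Q g)"

definition canonical_kernel ::
    "('a, 'g) tsystem \<Rightarrow> 'a set \<Rightarrow> ('a, 'g, 'b) crossed_product \<Rightarrow>
      ('a set, 'g, 'c) crossed_product \<Rightarrow> 'b set \<Rightarrow> bool"
  where "canonical_kernel S J P Q K \<longleftrightarrow>
    (\<exists>\<pi>. canonical_hom S J P Q \<pi> \<and> K = a_kernel (cp P) (cp Q) \<pi>)"

definition exact_system ::
    "('a, 'g) tsystem \<Rightarrow> ('a, 'g, 'b) crossed_product \<Rightarrow>
      ('a set \<Rightarrow> ('a set, 'g, 'c) crossed_product) \<Rightarrow> bool"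
  where "exact_system S P Q \<longleftrightarrow>
    (\<forall>J. invariant_ideal S J \<longrightarrow> canonical_kernel S J P (Q J) (induced_ideal P J))"

definition canonically_isomorphic_quotient ::
    "('a, 'g) tsystem \<Rightarrow> 'a set \<Rightarrow> ('a, 'g, 'b) crossed_product \<Rightarrow>
      ('a set, 'g, 'c) crossed_product \<Rightarrow> 'b set \<Rightarrow> bool"
  where "canonically_isomorphic_quotient S J P Q K \<longleftrightarrow>
    (\<exists>\<phi> \<in> star_iso (cstar_quot (cp P) K) (cp Q).
      (\<forall>a \<in> carrier (alg S). \<phi> (K +>\<^bsub>cp P\<^esub> emb P a) = emb Q (J +>\<^bsub>alg S\<^esub> a)) \<and>
      (\<forall>g \<in> carrier (grp S). \<phi> (K +>\<^bsub>cp P\<^esub> uni P g) = uni Q g))"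

end

theory Submission
  imports Defs
begin

text \<open>
  For a closed ideal \<open>K\<close> of the crossed product let \<open>J\<close> be the closure of \<open>E(K)\<close>, an invariant ideal
  of \<open>A\<close>.  If \<open>1\<close> were in \<open>J\<close>, then some self-adjoint \<open>x \<in> K\<close> would have \<open>E(x)\<close> close to \<open>1\<close>, and
  property (DP), applied to \<open>x - E(x)\<close>, would yield an element of \<open>K\<close> close to \<open>1\<close>; so \<open>J\<close> is proper
  when \<open>K\<close> is.  For \<open>x \<in> K\<close> the expectation of the quotient crossed product vanishes on the image of
  \<open>x\<^sup>* x\<close>, so by faithfulness \<open>x\<close> lies in the kernel of the canonical homomorphism, which by exactness
  is \<open>\<langle>J\<rangle>\<close>.  Thus every proper ideal \<open>K\<close> is contained in a proper ideal \<open>\<langle>J\<rangle>\<close>, and \<open>J\<close> is recovered from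
  \<open>\<langle>J\<rangle>\<close> by intersecting with \<open>A\<close>.

  Spectral theory is not needed: contractivity of *-homomorphisms and self-adjointness of closed
  ideals both follow from the square root of \<open>1 - a\<^sup>2\<close> for self-adjoint \<open>a\<close> with \<open>\<parallel>a\<parallel> < 1\<close>.
\<close>

section \<open>Norm estimates and convergence\<close>

text \<open>The intersection of K with A is proper whenever K is, but nothing forces K into the
  ideal which that intersection generates. The larger ideal obtained from E(K) does absorb K, at the
  price that its properness becomes the hard point. That the quotient expectation vanishes on the
  image of \<open>star x x\<close> rests on an intertwining identity: the expectation after
  \<open>\<pi>\<close> equals the quotient map after \<open>E\<close>. Both sides are additive
  contractions that agree on products of an element of A with some \<open>L g\<close>, and sums of
  such products are dense; this is one reason for establishing contractivity of homomorphisms early.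
  Self-adjointness of closed ideals serves twice: it supplies the self-adjoint element to which (DP)
  is applied, and it makes the involution on A/J independent of representatives. The closeness
  required in the properness argument is 1/2 twice: E(x) within 1/2 of 1 and the (DP) average within
  1/2 of 0 leave an element of K at distance less than 1 from 1, which no proper closed ideal
  contains.\<close>

lemma complex_field_simps [simp]:
  "carrier complex_field = UNIV" "x \<oplus>\<^bsub>complex_field\<^esub> y = x + y"
  "x \<otimes>\<^bsub>complex_field\<^esub> y = x * y" "\<one>\<^bsub>complex_field\<^esub> = 1" "\<zero>\<^bsub>complex_field\<^esub> = 0"
  by (simp_all add: complex_field_def)

text \<open>
  In \<open>unital_cstar_algebra\<close> the ring facts of the algebra are shadowed by those of the scalar
  field; this locale makes their short names available.
\<close>

locale cstar_alg = ring A for A :: "('a, 'm) cstar_scheme" (structure) +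
  assumes cstar: "unital_cstar_algebra A"

lemma cstar_algI: "unital_cstar_algebra A \<Longrightarrow> cstar_alg A"
  by (simp add: cstar_alg_axioms.intro cstar_alg_def unital_cstar_algebra_def)

context cstar_alg
begin

lemma module: "Module.module complex_field A"
  using cstar by (simp add: unital_cstar_algebra_def)

lemmas smult_mult_left = unital_cstar_algebra.smult_mult_left [OF cstar]
  and smult_mult_right = unital_cstar_algebra.smult_mult_right [OF cstar]
  and star_closed [simp, intro] = unital_cstar_algebra.star_closed [OF cstar]
  and star_star [simp] = unital_cstar_algebra.star_star [OF cstar]
  and star_add = unital_cstar_algebra.star_add [OF cstar]
  and star_mult = unital_cstar_algebra.star_mult [OF cstar]
  and star_smult = unital_cstar_algebra.star_smult [OF cstar]
  and norm_nonneg [simp] = unital_cstar_algebra.norm_nonneg [OF cstar]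
  and norm_eq_zero = unital_cstar_algebra.norm_eq_zero [OF cstar]
  and norm_triangle = unital_cstar_algebra.norm_triangle [OF cstar]
  and norm_smult = unital_cstar_algebra.norm_smult [OF cstar]
  and norm_mult = unital_cstar_algebra.norm_mult [OF cstar]
  and cstar_identity = unital_cstar_algebra.cstar_identity [OF cstar]
  and complete = unital_cstar_algebra.complete [OF cstar]

lemma smult_closed [simp, intro]: "x \<in> carrier A \<Longrightarrow> c \<odot> x \<in> carrier A"
  using module.smult_closed[OF module] by simp

lemma smult_add_left: "x \<in> carrier A \<Longrightarrow> (c + d) \<odot> x = c \<odot> x \<oplus> d \<odot> x"
  using module.smult_l_distr[OF module, of c d x] by simp

lemma smult_add_right:
  "\<lbrakk>x \<in> carrier A; y \<in> carrier A\<rbrakk> \<Longrightarrow> c \<odot> (x \<oplus> y) = c \<odot> x \<oplus> c \<odot> y"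
  using module.smult_r_distr[OF module, of c x y] by simp

lemma smult_smult: "x \<in> carrier A \<Longrightarrow> c \<odot> (d \<odot> x) = (c * d) \<odot> x"
  using module.smult_assoc1[OF module, of c d x] by simp

lemma smult_1 [simp]: "x \<in> carrier A \<Longrightarrow> 1 \<odot> x = x"
  using module.smult_one[OF module, of x] by simp

lemma smult_0 [simp]: "x \<in> carrier A \<Longrightarrow> 0 \<odot> x = \<zero>"
  using module.smult_l_null[OF module, of x] by simp

lemma smult_zero [simp]: "c \<odot> \<zero> = \<zero>"
  using module.smult_r_null[OF module, of c] by simp

lemma smult_minus_left: "x \<in> carrier A \<Longrightarrow> (- c) \<odot> x = \<ominus> (c \<odot> x)"
  using smult_add_left[of x "-c" c] minus_equality[of "(- c) \<odot> x" "c \<odot> x"] by simp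

lemma smult_minus_right: "x \<in> carrier A \<Longrightarrow> c \<odot> (\<ominus> x) = \<ominus> (c \<odot> x)"
  using smult_add_right[of "\<ominus> x" x c] minus_equality[of "c \<odot> (\<ominus> x)" "c \<odot> x"]
  by (simp add: l_neg)

lemma smult_diff_right:
  "\<lbrakk>x \<in> carrier A; y \<in> carrier A\<rbrakk> \<Longrightarrow> c \<odot> (x \<ominus> y) = c \<odot> x \<ominus> c \<odot> y"
  by (simp add: minus_eq smult_add_right smult_minus_right)

lemma mult_diff_right:
  "\<lbrakk>x \<in> carrier A; y \<in> carrier A; z \<in> carrier A\<rbrakk> \<Longrightarrow> x \<otimes> (y \<ominus> z) = x \<otimes> y \<ominus> x \<otimes> z"
  by (simp add: minus_eq r_distr r_minus)

lemma mult_diff_left: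
  "\<lbrakk>x \<in> carrier A; y \<in> carrier A; z \<in> carrier A\<rbrakk> \<Longrightarrow> (y \<ominus> z) \<otimes> x = y \<otimes> x \<ominus> z \<otimes> x"
  by (simp add: minus_eq l_distr l_minus)

lemma diff_add_diff:
  "\<lbrakk>x \<in> carrier A; y \<in> carrier A; z \<in> carrier A\<rbrakk> \<Longrightarrow> (x \<ominus> y) \<oplus> (y \<ominus> z) = x \<ominus> z"
  by (simp add: minus_eq a_assoc r_neg1)

lemma add_diff_add:
  "\<lbrakk>x \<in> carrier A; y \<in> carrier A; u \<in> carrier A; v \<in> carrier A\<rbrakk> \<Longrightarrow>
    (x \<oplus> y) \<ominus> (u \<oplus> v) = (x \<ominus> u) \<oplus> (y \<ominus> v)"
  by (simp add: minus_eq minus_add a_ac)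

lemma minus_diff:
  "\<lbrakk>x \<in> carrier A; y \<in> carrier A\<rbrakk> \<Longrightarrow> \<ominus> (x \<ominus> y) = y \<ominus> x"
  by (simp add: minus_eq minus_add a_ac)

lemma diff_add_cancel [simp]:
  "\<lbrakk>x \<in> carrier A; y \<in> carrier A\<rbrakk> \<Longrightarrow> (x \<ominus> y) \<oplus> y = x"
  by (simp add: minus_eq a_assoc l_neg)

lemma diff_zero [simp]: "x \<in> carrier A \<Longrightarrow> x \<ominus> \<zero> = x"
  by (simp add: minus_eq)

lemma diff_self [simp]: "x \<in> carrier A \<Longrightarrow> x \<ominus> x = \<zero>"
  by (simp add: minus_eq r_neg)

lemma diff_eq_zero_iff:
  "\<lbrakk>x \<in> carrier A; y \<in> carrier A\<rbrakk> \<Longrightarrow> x \<ominus> y = \<zero> \<longleftrightarrow> x = y"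
  by (metis diff_add_cancel l_zero diff_self)

lemma star_minus: "x \<in> carrier A \<Longrightarrow> star A (\<ominus> x) = \<ominus> star A x"
  using star_smult[of x "-1"] by (simp add: smult_minus_left)

lemma star_diff:
  "\<lbrakk>x \<in> carrier A; y \<in> carrier A\<rbrakk> \<Longrightarrow> star A (x \<ominus> y) = star A x \<ominus> star A y"
  by (simp add: minus_eq star_add star_minus)

lemma star_zero [simp]: "star A \<zero> = \<zero>"
  using star_diff[of \<zero> \<zero>] by simp

lemma star_one [simp]: "star A \<one> = \<one>"
  by (metis l_one one_closed r_one star_closed star_mult star_star)

lemma norm_zero [simp]: "nrm A \<zero> = 0"
  by (simp add: norm_eq_zero)

lemma norm_minus [simp]: "x \<in> carrier A \<Longrightarrow> nrm A (\<ominus> x) = nrm A x"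
  using norm_smult[of x "-1"] by (simp add: smult_minus_left)

lemma norm_diff_commute:
  "\<lbrakk>x \<in> carrier A; y \<in> carrier A\<rbrakk> \<Longrightarrow> nrm A (x \<ominus> y) = nrm A (y \<ominus> x)"
  by (metis minus_diff minus_closed norm_minus)

lemma norm_diff_le:
  "\<lbrakk>x \<in> carrier A; y \<in> carrier A\<rbrakk> \<Longrightarrow> nrm A (x \<ominus> y) \<le> nrm A x + nrm A y"
  using norm_triangle[of x "\<ominus> y"] by (simp add: minus_eq)

lemma norm_diff_triangle:
  "\<lbrakk>x \<in> carrier A; y \<in> carrier A; z \<in> carrier A\<rbrakk> \<Longrightarrow>
    nrm A (x \<ominus> z) \<le> nrm A (x \<ominus> y) + nrm A (y \<ominus> z)"
  using norm_triangle[of "x \<ominus> y" "y \<ominus> z"] by (simp add: diff_add_diff)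

text \<open>The C*-identity and submultiplicativity give ||y||^2 <= ||star y|| ||y||. Cancelling
  ||y||, for y = x and for y = \<open>star A x\<close>, gives both inequalities.\<close>

lemma norm_star [simp]: assumes "x \<in> carrier A" shows "nrm A (star A x) = nrm A x"
proof -
  have le: "nrm A y \<le> nrm A (star A y)" if y: "y \<in> carrier A" for y
  proof (cases "nrm A y = 0")
    case False
    then have "nrm A y > 0" using norm_nonneg[OF y] by linarith
    moreover have "nrm A y * nrm A y \<le> nrm A (star A y) * nrm A y"
      using cstar_identity[OF y] norm_mult[of "star A y" y] y by (simp add: power2_eq_square)
    ultimately show ?thesis by simp
  qed (use y in simp)
  show ?thesis
    using le[of x] le[of "star A x"] assms by simp
qed

lemma norm_self_adjoint_sq:
  "\<lbrakk>x \<in> carrier A; star A x = x\<rbrakk> \<Longrightarrow> nrm A (x \<otimes> x) = (nrm A x)\<^sup>2"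
  using cstar_identity[of x] by simp

text \<open>Since 1 is a self-adjoint idempotent, ||1||^2 = ||1||. In the zero algebra, which is
  allowed, this norm is 0.\<close>

lemma norm_one_le: "nrm A \<one> \<le> 1"
  using norm_self_adjoint_sq[of \<one>] by (auto simp: power2_eq_square)

lemma norm_unitary_le: "u \<in> unitaries A \<Longrightarrow> nrm A u \<le> 1"
  using cstar_identity[of u] norm_one_le
  by (auto simp: unitaries_def) (metis norm_nonneg power2_le_imp_le one_power2 zero_le_one)

lemma eq_if_norm_diff_small:
  assumes "x \<in> carrier A" "y \<in> carrier A" "\<And>e. e > 0 \<Longrightarrow> nrm A (x \<ominus> y) \<le> e"
  shows "x = y"
proof -
  have "nrm A (x \<ominus> y) \<le> 0"
    using assms(3) by (rule field_le_epsilon[of _ 0, simplified])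
  then have "nrm A (x \<ominus> y) = 0"
    using assms(1,2) by (intro antisym) auto
  then show ?thesis
    using assms(1,2) by (simp add: norm_eq_zero diff_eq_zero_iff)
qed

section \<open>The norm topology in terms of approximation\<close>

lemma metric: "Metric_space (carrier A) (cstar_dist A)"
  by unfold_locales
    (auto simp: cstar_dist_def norm_diff_commute norm_eq_zero diff_eq_zero_iff norm_diff_triangle)

lemma closedin_iff:
  "closedin (cstar_topology A) T \<longleftrightarrow> T \<subseteq> carrier A \<and>
    (\<forall>x\<in>carrier A. (\<forall>e>0. \<exists>t\<in>T. nrm A (x \<ominus> t) < e) \<longrightarrow> x \<in> T)"
proof -
  interpret Metric_space "carrier A" "cstar_dist A" by (rule metric)
  have *: "disjnt T (mball x r) \<longleftrightarrow> (\<forall>t\<in>T. \<not> nrm A (x \<ominus> t) < r)"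
    if "T \<subseteq> carrier A" "x \<in> carrier A" for x r
    using that by (auto simp: disjnt_iff cstar_dist_def)
  have "(\<forall>x\<in>carrier A - T. \<exists>r>0. disjnt T (mball x r)) \<longleftrightarrow>
      (\<forall>x\<in>carrier A. (\<forall>e>0. \<exists>t\<in>T. nrm A (x \<ominus> t) < e) \<longrightarrow> x \<in> T)"
    if "T \<subseteq> carrier A"
    using *[OF that] by blast
  then show ?thesis
    unfolding closedin_metric by blast
qed

lemma closure_of_iff:
  assumes "T \<subseteq> carrier A"
  shows "x \<in> cstar_topology A closure_of T \<longleftrightarrow>
    x \<in> carrier A \<and> (\<forall>e>0. \<exists>t\<in>T. nrm A (x \<ominus> t) < e)"
proof -
  interpret Metric_space "carrier A" "cstar_dist A" by (rule metric)
  show ?thesis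
    using assms by (auto simp: metric_closure_of cstar_dist_def) (metis subsetD)
qed

lemma closedinD:
  "\<lbrakk>closedin (cstar_topology A) T; x \<in> carrier A; \<And>e. e > 0 \<Longrightarrow> \<exists>t\<in>T. nrm A (x \<ominus> t) < e\<rbrakk>
    \<Longrightarrow> x \<in> T"
  by (auto simp: closedin_iff)

text \<open>Completeness enters through this lemma: the geometric series bounds the distance from
  \<open>x m\<close> to all later terms by s^m/(1 - s). It provides the limit of the fixed-point
  iteration for square roots.\<close>

lemma geometric_convergent:
  assumes x: "\<And>n. x n \<in> carrier A" and s: "0 \<le> s" "s < (1::real)"
    and le: "\<And>n. nrm A (x (Suc n) \<ominus> x n) \<le> s ^ n"
  shows "\<exists>l\<in>carrier A. \<forall>e>0. \<exists>N. \<forall>n\<ge>N. nrm A (x n \<ominus> l) < e"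
proof -
  interpret Metric_space "carrier A" "cstar_dist A" by (rule metric)
  have tail: "nrm A (x (m + k) \<ominus> x m) \<le> s ^ m * (1 - s ^ k) / (1 - s)" for m k
  proof (induction k)
    case (Suc k)
    have "nrm A (x (m + Suc k) \<ominus> x m) \<le> s ^ (m + k) + s ^ m * (1 - s ^ k) / (1 - s)"
      using norm_diff_triangle[of "x (m + Suc k)" "x (m + k)" "x m"] le[of "m + k"] Suc x by simp
    also have "\<dots> = s ^ m * (1 - s ^ Suc k) / (1 - s)"
      using s by (simp add: field_simps power_add)
    finally show ?case .
  qed (simp add: x)
  have bound: "nrm A (x n \<ominus> x m) \<le> s ^ m / (1 - s)" if "m \<le> n" for m n
  proof -
    have "s ^ m * (1 - s ^ (n - m)) / (1 - s) \<le> s ^ m / (1 - s)"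
      using s by (intro divide_right_mono) (auto simp: mult_left_le)
    then show ?thesis
      using tail[of m "n - m"] that by simp
  qed
  have "MCauchy x"
    unfolding MCauchy_def
  proof (intro conjI allI impI)
    show "range x \<subseteq> carrier A" using x by auto
    fix e :: real assume "e > 0"
    then have "0 < e * (1 - s)" using s by simp
    then obtain N where N: "s ^ N < e * (1 - s)"
      using real_arch_pow_inv s(2) by blast
    have small: "s ^ m / (1 - s) < e" if "m \<ge> N" for m
    proof -
      have "s ^ m \<le> s ^ N" using that s by (simp add: power_decreasing)
      then show ?thesis using N s by (simp add: pos_divide_less_eq)
    qed
    show "\<exists>N. \<forall>n n'. N \<le> n \<longrightarrow> N \<le> n' \<longrightarrow> cstar_dist A (x n) (x n') < e"
    proof (intro exI[of _ N] allI impI)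
      fix n n' assume "N \<le> n" "N \<le> n'"
      then show "cstar_dist A (x n) (x n') < e"
        using bound[of n n'] bound[of n' n] small[of n] small[of n'] x
        by (cases "n \<le> n'") (auto simp: cstar_dist_def norm_diff_commute[of "x n" "x n'"])
    qed
  qed
  then obtain l where "limitin mtopology x l sequentially"
    using complete by (auto simp: mcomplete_def)
  then have l: "l \<in> carrier A" "\<forall>e>0. \<forall>\<^sub>F n in sequentially. x n \<in> carrier A \<and> cstar_dist A (x n) l < e"
    by (auto simp: limitin_metric)
  then show ?thesis
    using x by (intro bexI[of _ l]) (auto simp: cstar_dist_def eventually_sequentially)
qed

end

section \<open>Square roots and contractivity of *-homomorphisms\<close>

context cstar_alg
begin

lemma half_add_self [simp]: "x \<in> carrier A \<Longrightarrow> (1/2) \<odot> (x \<oplus> x) = x"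
  using smult_add_left[of x "1/2" "1/2"] by (simp add: smult_add_right)

lemma norm_half_le:
  assumes "x \<in> carrier A" "y \<in> carrier A"
  shows "nrm A ((1/2) \<odot> (x \<oplus> y)) \<le> (nrm A x + nrm A y) / 2"
  using norm_triangle[OF assms] assms by (simp add: norm_smult)

text \<open>The element \<open>1 - c\<close> is constructed as the fixed point of \<open>w \<mapsto> (a\<^sup>2 + w\<^sup>2)/2\<close>.\<close>

lemma sqrt_one_minus_square:
  assumes a: "a \<in> carrier A" "star A a = a" "nrm A a < 1"
  shows "\<exists>c\<in>carrier A. star A c = c \<and> c \<otimes> a = a \<otimes> c \<and> a \<otimes> a \<oplus> c \<otimes> c = \<one>"
proof -
  define h where "h = a \<otimes> a"
  define s where "s = (nrm A a)\<^sup>2"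
  \<comment> \<open>Expanding (1 - w)^2 = 1 - h turns it into the fixed-point equation w = (h +
    w^2)/2.\<close>
  define T where "T = (\<lambda>w. (1/2) \<odot> (h \<oplus> w \<otimes> w))"
  define w where "w = (\<lambda>n. (T ^^ n) \<zero>)"
  have h: "h \<in> carrier A" "star A h = h" "h \<otimes> a = a \<otimes> h" "nrm A h = s"
    using a by (auto simp: h_def s_def star_mult m_assoc norm_self_adjoint_sq)
  have s: "0 \<le> s" "s < 1"
    using a by (simp_all add: s_def abs_square_less_1)
  have w_Suc: "w (Suc n) = T (w n)" for n by (simp add: w_def)
  have T_closed: "T v \<in> carrier A" if "v \<in> carrier A" for v
    using that h by (simp add: T_def)
  \<comment> \<open>The ball of radius s is preserved because (s + s^2)/2 <= s; self-adjointness and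
    commutation with a pass through \<open>T\<close>.\<close>
  have w: "w n \<in> carrier A \<and> star A (w n) = w n \<and> w n \<otimes> a = a \<otimes> w n \<and> nrm A (w n) \<le> s" for n
  proof (induction n)
    case (Suc n)
    then have IH: "w n \<in> carrier A" "star A (w n) = w n" "w n \<otimes> a = a \<otimes> w n" "nrm A (w n) \<le> s"
      by auto
    have "w n \<otimes> w n \<otimes> a = a \<otimes> (w n \<otimes> w n)"
      using IH a by (metis m_assoc)
    moreover have "nrm A (T (w n)) \<le> s"
    proof -
      have "nrm A (w n \<otimes> w n) \<le> s * s"
        using norm_mult[of "w n" "w n"] IH s by (intro order_trans[OF norm_mult] mult_mono) auto
      also have "\<dots> \<le> s" using s by (simp add: mult_left_le)
      finally show ?thesis
        using norm_half_le[of h "w n \<otimes> w n"] IH h by (simp add: T_def)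
    qed
    ultimately show ?case
      using IH h a
      by (simp add: w_Suc T_closed)
        (simp add: T_def star_smult star_add star_mult smult_mult_left smult_mult_right l_distr r_distr)
  qed (use a s in \<open>simp add: w_def\<close>)
  have T_diff: "nrm A (T u \<ominus> T v) \<le> (nrm A u + nrm A v) / 2 * nrm A (u \<ominus> v)"
    if uv: "u \<in> carrier A" "v \<in> carrier A" for u v
  proof -
    have "T u \<ominus> T v = (1/2) \<odot> (u \<otimes> u \<ominus> v \<otimes> v)"
      using uv h by (simp add: T_def smult_diff_right[symmetric] add_diff_add)
    \<comment> \<open>A difference of squares for elements that need not commute. On the ball of
      radius s it makes \<open>T\<close> Lipschitz with constant s < 1.\<close>
    also have "u \<otimes> u \<ominus> v \<otimes> v = u \<otimes> (u \<ominus> v) \<oplus> (u \<ominus> v) \<otimes> v"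
      using uv by (simp add: mult_diff_left mult_diff_right diff_add_diff)
    also have "nrm A ((1/2) \<odot> \<dots>) \<le> (nrm A u * nrm A (u \<ominus> v) + nrm A (u \<ominus> v) * nrm A v) / 2"
      using norm_half_le[of "u \<otimes> (u \<ominus> v)" "(u \<ominus> v) \<otimes> v"] norm_mult[of u "u \<ominus> v"]
        norm_mult[of "u \<ominus> v" v] uv by simp
    finally show ?thesis by (simp add: field_simps)
  qed
  have steps: "nrm A (w (Suc n) \<ominus> w n) \<le> s ^ n" for n
  proof (induction n)
    case 0
    then show ?case
      using w[of "Suc 0"] s by (simp add: w_def)
  next
    case (Suc n)
    have "(nrm A (w (Suc n)) + nrm A (w n)) / 2 \<le> s"
      using w[of n] w[of "Suc n"] by simp
    then have "nrm A (w (Suc (Suc n)) \<ominus> w (Suc n)) \<le> s * nrm A (w (Suc n) \<ominus> w n)"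
      using T_diff[of "w (Suc n)" "w n"] w
      by (simp only: w_Suc[of "Suc n"] w_Suc[of n, symmetric])
        (meson T_diff mult_right_mono norm_nonneg minus_closed order_trans)
    also have "\<dots> \<le> s * s ^ n" using Suc s by (intro mult_left_mono)
    finally show ?case by simp
  qed
  obtain l where l: "l \<in> carrier A" and lim: "\<And>e. e > 0 \<Longrightarrow> \<exists>N. \<forall>n\<ge>N. nrm A (w n \<ominus> l) < e"
    using geometric_convergent[of w s] w s steps by auto
  \<comment> \<open>Passage to the limit for an identity F = G that holds along the iteration, given
    Lipschitz bounds relative to l. It yields self-adjointness of l and its commutation with
    a.\<close>
  have fixed: "F l = G l"
    if F: "F l \<in> carrier A" "G l \<in> carrier A" "\<And>n. F (w n) \<in> carrier A" "\<And>n. G (w n) \<in> carrier A"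
      and eq: "\<And>n. F (w n) = G (w n)"
      and K: "0 \<le> K" "\<And>n. nrm A (F (w n) \<ominus> F l) \<le> K * nrm A (w n \<ominus> l)"
        "\<And>n. nrm A (G (w n) \<ominus> G l) \<le> K * nrm A (w n \<ominus> l)" for F G K
  proof (rule eq_if_norm_diff_small[OF F(1,2)])
    fix e :: real assume "e > 0"
    then have "e / (2 * (K + 1)) > 0" using K by simp
    then obtain n where n: "nrm A (w n \<ominus> l) < e / (2 * (K + 1))" using lim by blast
    have "nrm A (F l \<ominus> G l) \<le> nrm A (F l \<ominus> F (w n)) + nrm A (G (w n) \<ominus> G l)"
      using norm_diff_triangle[of "F l" "F (w n)" "G l"] F eq by simp
    also have "\<dots> \<le> 2 * (K + 1) * nrm A (w n \<ominus> l)"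
    proof -
      have "nrm A (w n \<ominus> l) \<ge> 0" using w l by simp
      then show ?thesis
        using K(2)[of n] K(3)[of n] F by (simp add: norm_diff_commute[of "F l"] algebra_simps)
    qed
    also have "\<dots> \<le> e" using n K by (simp add: field_simps)
    finally show "nrm A (F l \<ominus> G l) \<le> e" .
  qed
  have star_l: "star A l = l"
  proof -
    have "nrm A (star A (w n) \<ominus> star A l) = nrm A (w n \<ominus> l)" for n
      using w l by (metis star_diff norm_star minus_closed)
    then show ?thesis
      using w l by (intro fixed[of "star A" "\<lambda>x. x" 1]) auto
  qed
  have comm: "l \<otimes> a = a \<otimes> l"
  proof -
    have "nrm A (w n \<otimes> a \<ominus> l \<otimes> a) \<le> nrm A a * nrm A (w n \<ominus> l)"
      "nrm A (a \<otimes> w n \<ominus> a \<otimes> l) \<le> nrm A a * nrm A (w n \<ominus> l)" for n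
      using norm_mult[of "w n \<ominus> l" a] norm_mult[of a "w n \<ominus> l"] w l a
      by (simp_all add: mult_diff_left mult_diff_right mult.commute)
    then show ?thesis
      using w l a
      by (intro fixed[of "\<lambda>x. x \<otimes> a" "\<lambda>x. a \<otimes> x" "nrm A a"]) auto
  qed
  \<comment> \<open>Here \<open>fixed\<close> does not fit: \<open>T (w n)\<close> is
    \<open>w (Suc n)\<close>, so the errors at two consecutive indices are controlled
    together.\<close>
  have "T l = l"
  proof (rule eq_if_norm_diff_small)
    fix e :: real assume e: "e > 0"
    \<comment> \<open>C - 1 bounds the Lipschitz factor of \<open>T\<close> between
      \<open>w n\<close> and l; the extra 1 accounts for the error at the next index, so that the
      total is C * e/(2C) = e/2.\<close>
    define C where "C = (s + nrm A l) / 2 + 1"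
    have C: "C > 0" using s l by (simp add: C_def add_nonneg_pos)
    then have "e / (2 * C) > 0" using e by simp
    from lim[OF this] obtain n
      where n: "nrm A (w n \<ominus> l) < e / (2 * C)" "nrm A (w (Suc n) \<ominus> l) < e / (2 * C)"
      by (meson le_Suc_eq order_refl)
    have "nrm A (T l \<ominus> l) \<le> nrm A (T (w n) \<ominus> T l) + nrm A (w (Suc n) \<ominus> l)"
      using norm_diff_triangle[of "T l" "T (w n)" l] w l
      by (simp add: T_closed w_Suc norm_diff_commute[of "T l"])
    also have "nrm A (T (w n) \<ominus> T l) \<le> (C - 1) * nrm A (w n \<ominus> l)"
      using w[of n] l
      by (intro order_trans[OF T_diff] mult_right_mono) (auto simp: C_def)
    also have "\<dots> \<le> (C - 1) * (e / (2 * C))"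
      using n s l by (intro mult_left_mono) (auto simp: C_def)
    also have "(C - 1) * (e / (2 * C)) + nrm A (w (Suc n) \<ominus> l) \<le> (C - 1) * (e / (2 * C)) + e / (2 * C)"
      using n by simp
    also have "\<dots> = e / 2" using C by (simp add: field_simps)
    finally show "nrm A (T l \<ominus> l) \<le> e" using e by simp
  qed (use l T_closed in auto)
  then have "l \<oplus> l = (1/2 + 1/2) \<odot> (h \<oplus> l \<otimes> l)"
    using l h smult_add_left[of "h \<oplus> l \<otimes> l" "1/2" "1/2"] by (simp add: T_def)
  then have twice: "l \<oplus> l = h \<oplus> l \<otimes> l"
    using l h by simp
  have "h \<oplus> (\<one> \<ominus> l) \<otimes> (\<one> \<ominus> l) = \<one> \<oplus> (h \<oplus> l \<otimes> l) \<ominus> (l \<oplus> l)"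
    using l h by (simp add: minus_eq l_distr r_distr l_minus r_minus minus_add a_ac)
  also have "\<dots> = \<one>"
    using l h by (simp add: twice minus_eq a_assoc r_neg)
  finally show ?thesis
    using l a star_l comm
    by (intro bexI[of _ "\<one> \<ominus> l"])
      (auto simp: h_def star_diff mult_diff_left mult_diff_right)
qed

text \<open>For commuting self-adjoint \<open>a\<close> and \<open>c\<close> with \<open>a\<^sup>2 + c\<^sup>2 = 1\<close> the element \<open>a + \<i>c\<close> is unitary.\<close>

lemma norm_le_1_if_squares_add_up:
  assumes a: "a \<in> carrier A" "star A a = a" and c: "c \<in> carrier A" "star A c = c"
    and ac: "c \<otimes> a = a \<otimes> c" "a \<otimes> a \<oplus> c \<otimes> c = \<one>"
  shows "nrm A a \<le> 1"
proof -
  define u where "u = a \<oplus> \<i> \<odot> c"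
  have u: "u \<in> carrier A" and su: "star A u = a \<ominus> \<i> \<odot> c"
    using a c by (auto simp: u_def star_add star_smult minus_eq smult_minus_left)
  \<comment> \<open>The cross terms \<i>(ac - ca) cancel because a and c commute.\<close>
  have "star A u \<otimes> u = a \<otimes> a \<oplus> c \<otimes> c"
    unfolding su using a c ac(1)
    by (simp add: u_def minus_eq l_distr r_distr l_minus smult_mult_left smult_mult_right
        smult_smult smult_minus_left smult_minus_right smult_add_right a_ac r_neg r_neg1 r_neg2)
  then have "(nrm A u)\<^sup>2 \<le> 1"
    using cstar_identity[OF u] ac(2) norm_one_le by simp
  then have "nrm A u \<le> 1"
    using u by (simp add: power2_nonneg_ge_1_iff abs_square_le_1)
  \<comment> \<open>As the real part of u, the element a has norm at most the mean of the norms of u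
    and its adjoint.\<close>
  moreover have "a = (1/2) \<odot> (u \<oplus> star A u)"
  proof -
    have "u \<oplus> star A u = a \<oplus> a"
      unfolding su using a c by (simp add: u_def minus_eq a_ac r_neg r_neg1 r_neg2)
    then show ?thesis using a by simp
  qed
  ultimately show ?thesis
    using norm_half_le[of u "star A u"] u by simp
qed

end

lemma star_homD:
  assumes "\<phi> \<in> star_hom A B"
  shows "x \<in> carrier A \<Longrightarrow> \<phi> x \<in> carrier B"
    and "\<lbrakk>x \<in> carrier A; y \<in> carrier A\<rbrakk> \<Longrightarrow> \<phi> (x \<otimes>\<^bsub>A\<^esub> y) = \<phi> x \<otimes>\<^bsub>B\<^esub> \<phi> y"
    and "\<lbrakk>x \<in> carrier A; y \<in> carrier A\<rbrakk> \<Longrightarrow> \<phi> (x \<oplus>\<^bsub>A\<^esub> y) = \<phi> x \<oplus>\<^bsub>B\<^esub> \<phi> y"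
    and "\<phi> \<one>\<^bsub>A\<^esub> = \<one>\<^bsub>B\<^esub>"
    and "x \<in> carrier A \<Longrightarrow> \<phi> (c \<odot>\<^bsub>A\<^esub> x) = c \<odot>\<^bsub>B\<^esub> \<phi> x"
    and "x \<in> carrier A \<Longrightarrow> \<phi> (star A x) = star B (\<phi> x)"
  using assms by (auto simp: star_hom_def ring_hom_def)

lemma star_hom_zero:
  assumes "\<phi> \<in> star_hom A B" "cstar_alg A" "cstar_alg B"
  shows "\<phi> \<zero>\<^bsub>A\<^esub> = \<zero>\<^bsub>B\<^esub>"
proof -
  interpret A: cstar_alg A by fact
  interpret B: cstar_alg B by fact
  show ?thesis
    using star_homD(5)[OF assms(1), of "\<zero>\<^bsub>A\<^esub>" 0] star_homD(1)[OF assms(1), of "\<zero>\<^bsub>A\<^esub>"] by simp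
qed

lemma star_hom_diff:
  assumes "\<phi> \<in> star_hom A B" "cstar_alg A" "cstar_alg B" "x \<in> carrier A" "y \<in> carrier A"
  shows "\<phi> (x \<ominus>\<^bsub>A\<^esub> y) = \<phi> x \<ominus>\<^bsub>B\<^esub> \<phi> y"
proof -
  interpret A: cstar_alg A by fact
  interpret B: cstar_alg B by fact
  note h = star_homD[OF assms(1)]
  have "\<phi> (\<ominus>\<^bsub>A\<^esub> y) = \<ominus>\<^bsub>B\<^esub> \<phi> y"
    using h(5)[of y "-1"] h(1)[of y] assms(5) by (simp add: A.smult_minus_left B.smult_minus_left)
  then show ?thesis
    using assms(4,5) by (simp add: A.minus_eq B.minus_eq h)
qed

text \<open>
  A self-adjoint element of norm less than one has a partner \<open>c\<close> with \<open>a\<^sup>2 + c\<^sup>2 = 1\<close>, and this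
  relation is preserved by the homomorphism.
\<close>

lemma star_hom_contractive:
  assumes hom: "\<phi> \<in> star_hom A B" and "cstar_alg A" "cstar_alg B" and x: "x \<in> carrier A"
  shows "nrm B (\<phi> x) \<le> nrm A x"
proof -
  interpret A: cstar_alg A by fact
  interpret B: cstar_alg B by fact
  note h = star_homD[OF hom]
  have unit: "nrm B (\<phi> a) \<le> 1" if a: "a \<in> carrier A" "star A a = a" "nrm A a < 1" for a
  proof -
    obtain c where c: "c \<in> carrier A" "star A c = c" "c \<otimes>\<^bsub>A\<^esub> a = a \<otimes>\<^bsub>A\<^esub> c"
      "a \<otimes>\<^bsub>A\<^esub> a \<oplus>\<^bsub>A\<^esub> c \<otimes>\<^bsub>A\<^esub> c = \<one>\<^bsub>A\<^esub>"
      using A.sqrt_one_minus_square[OF a] by auto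
    show ?thesis
    proof (rule B.norm_le_1_if_squares_add_up)
      show "\<phi> a \<in> carrier B" "\<phi> c \<in> carrier B" using a c h by auto
      show "star B (\<phi> a) = \<phi> a" "star B (\<phi> c) = \<phi> c" using a c h(6) by metis+
      show "\<phi> c \<otimes>\<^bsub>B\<^esub> \<phi> a = \<phi> a \<otimes>\<^bsub>B\<^esub> \<phi> c" using a c h(2) by metis
      show "\<phi> a \<otimes>\<^bsub>B\<^esub> \<phi> a \<oplus>\<^bsub>B\<^esub> \<phi> c \<otimes>\<^bsub>B\<^esub> \<phi> c = \<one>\<^bsub>B\<^esub>"
      proof -
        have "\<phi> (a \<otimes>\<^bsub>A\<^esub> a \<oplus>\<^bsub>A\<^esub> c \<otimes>\<^bsub>A\<^esub> c) = \<phi> a \<otimes>\<^bsub>B\<^esub> \<phi> a \<oplus>\<^bsub>B\<^esub> \<phi> c \<otimes>\<^bsub>B\<^esub> \<phi> c"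
          using a c(1) by (simp add: h(2,3))
        then show ?thesis by (simp add: c(4) h(4))
      qed
    qed
  qed
  \<comment> \<open>For t > ||a|| the element a/t has norm below 1, so \<open>unit\<close> bounds
    the norm of the image of a by t; then t decreases to ||a||.\<close>
  have sa: "nrm B (\<phi> a) \<le> nrm A a" if a: "a \<in> carrier A" "star A a = a" for a
  proof (rule dense_ge)
    fix t assume t: "nrm A a < t"
    then have "t > 0" using A.norm_nonneg[OF a(1)] by linarith
    then have "nrm B (\<phi> (complex_of_real (1/t) \<odot>\<^bsub>A\<^esub> a)) \<le> 1"
      using a t by (intro unit) (auto simp: A.star_smult A.norm_smult norm_divide)
    then show "nrm B (\<phi> a) \<le> t"
      using \<open>t > 0\<close> a h by (simp add: B.norm_smult norm_divide)
  qed
  \<comment> \<open>The C*-identity reduces the general case to the self-adjoint element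
    \<open>star x x\<close>.\<close>
  have "(nrm B (\<phi> x))\<^sup>2 = nrm B (\<phi> (star A x \<otimes>\<^bsub>A\<^esub> x))"
    using x h B.cstar_identity[of "\<phi> x"] by simp
  also have "\<dots> \<le> (nrm A x)\<^sup>2"
    using sa[of "star A x \<otimes>\<^bsub>A\<^esub> x"] x by (simp add: A.star_mult A.cstar_identity)
  finally show ?thesis
    using x by (simp add: power2_le_iff_abs_le)
qed

section \<open>Closed ideals\<close>

lemma a_kernel_eq: "a_kernel A B \<phi> = {x \<in> carrier A. \<phi> x = \<zero>\<^bsub>B\<^esub>}"
  by (simp add: a_kernel_def kernel_def)

lemma closed_idealD:
  assumes "closed_ideal K A"
  shows "K \<subseteq> carrier A" "x \<in> K \<Longrightarrow> x \<in> carrier A" "\<zero>\<^bsub>A\<^esub> \<in> K"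
    and "\<lbrakk>x \<in> K; y \<in> K\<rbrakk> \<Longrightarrow> x \<oplus>\<^bsub>A\<^esub> y \<in> K"
    and "\<lbrakk>x \<in> K; y \<in> K\<rbrakk> \<Longrightarrow> x \<ominus>\<^bsub>A\<^esub> y \<in> K"
    and "\<lbrakk>x \<in> K; y \<in> carrier A\<rbrakk> \<Longrightarrow> x \<otimes>\<^bsub>A\<^esub> y \<in> K"
    and "\<lbrakk>x \<in> K; y \<in> carrier A\<rbrakk> \<Longrightarrow> y \<otimes>\<^bsub>A\<^esub> x \<in> K"
proof -
  interpret ideal K A using assms by (simp add: closed_ideal_def)
  show "K \<subseteq> carrier A" "x \<in> K \<Longrightarrow> x \<in> carrier A" "\<zero>\<^bsub>A\<^esub> \<in> K"
    "\<lbrakk>x \<in> K; y \<in> K\<rbrakk> \<Longrightarrow> x \<oplus>\<^bsub>A\<^esub> y \<in> K"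
    "\<lbrakk>x \<in> K; y \<in> K\<rbrakk> \<Longrightarrow> x \<ominus>\<^bsub>A\<^esub> y \<in> K"
    "\<lbrakk>x \<in> K; y \<in> carrier A\<rbrakk> \<Longrightarrow> x \<otimes>\<^bsub>A\<^esub> y \<in> K"
    "\<lbrakk>x \<in> K; y \<in> carrier A\<rbrakk> \<Longrightarrow> y \<otimes>\<^bsub>A\<^esub> x \<in> K"
    using a_subset by (auto intro: I_l_closed I_r_closed simp: minus_eq)
qed

context cstar_alg
begin

text \<open>Closure under negation follows from absorption, since -x = (-1)x in a unital
  ring.\<close>

lemma closed_idealI:
  assumes "K \<subseteq> carrier A" "\<zero> \<in> K"
    and "\<And>x y. \<lbrakk>x \<in> K; y \<in> K\<rbrakk> \<Longrightarrow> x \<oplus> y \<in> K"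
    and "\<And>x y. \<lbrakk>x \<in> K; y \<in> carrier A\<rbrakk> \<Longrightarrow> x \<otimes> y \<in> K"
    and "\<And>x y. \<lbrakk>x \<in> K; y \<in> carrier A\<rbrakk> \<Longrightarrow> y \<otimes> x \<in> K"
    and "\<And>x. \<lbrakk>x \<in> carrier A; \<And>e. e > 0 \<Longrightarrow> \<exists>k\<in>K. nrm A (x \<ominus> k) < e\<rbrakk> \<Longrightarrow> x \<in> K"
  shows "closed_ideal K A"
proof -
  have neg: "\<ominus> x \<in> K" if "x \<in> K" for x
  proof -
    have "\<ominus> x = (\<ominus> \<one>) \<otimes> x" using that assms(1) by (auto simp: l_minus)
    then show ?thesis using that assms(5)[of x "\<ominus> \<one>"] by simp
  qed
  have "ideal K A"
  proof (rule idealI[OF ring_axioms])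
    show "subgroup K (add_monoid A)"
      using assms(1,2,3) neg by (intro subgroup.intro) (auto simp: a_inv_def[symmetric])
  qed (use assms in auto)
  then show ?thesis
    using assms(1,6) by (auto simp: closed_ideal_def closedin_iff)
qed

lemma closed_ideal_closed:
  "\<lbrakk>closed_ideal K A; x \<in> carrier A; \<And>e. e > 0 \<Longrightarrow> \<exists>k\<in>K. nrm A (x \<ominus> k) < e\<rbrakk> \<Longrightarrow> x \<in> K"
  by (auto simp: closed_ideal_def intro: closedinD)

text \<open>The predicate \<open>ideal\<close> concerns rings only; scalar multiples stay inside
  because cx = (c1)x in a unital algebra.\<close>

lemma closed_ideal_smult:
  assumes "closed_ideal K A" "x \<in> K" shows "c \<odot> x \<in> K"
proof -
  have "c \<odot> x = (c \<odot> \<one>) \<otimes> x"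
    using closed_idealD(2)[OF assms] by (simp add: smult_mult_left)
  then show ?thesis using closed_idealD(7)[OF assms, of "c \<odot> \<one>"] by simp
qed

lemma closed_ideal_carrier: "closed_ideal (carrier A) A"
  by (rule closed_idealI) auto

lemma closed_ideal_singleton: "closed_ideal {\<zero>} A"
proof (rule closed_idealI)
  fix x assume x: "x \<in> carrier A" "\<And>e. e > 0 \<Longrightarrow> \<exists>k\<in>{\<zero>}. nrm A (x \<ominus> k) < e"
  have "x = \<zero>"
    using x by (intro eq_if_norm_diff_small) (auto intro!: less_imp_le)
  then show "x \<in> {\<zero>}" by simp
qed auto

lemma closed_ideal_Inter:
  assumes "\<And>K. K \<in> F \<Longrightarrow> closed_ideal K A" "F \<noteq> {}" shows "closed_ideal (\<Inter>F) A"
proof (rule closed_idealI)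
  fix x assume x: "x \<in> carrier A" "\<And>e. e > 0 \<Longrightarrow> \<exists>k\<in>\<Inter>F. nrm A (x \<ominus> k) < e"
  show "x \<in> \<Inter>F"
  proof
    fix K assume "K \<in> F"
    then show "x \<in> K" using x assms(1) by (intro closed_ideal_closed[of K]) blast+
  qed
next
  obtain K where "K \<in> F" using assms(2) by blast
  then show "\<Inter> F \<subseteq> carrier A" using closed_idealD(1)[OF assms(1)] by blast
qed (auto intro: closed_idealD[OF assms(1)])

lemma closed_ideal_genideal: "Y \<subseteq> carrier A \<Longrightarrow> closed_ideal (closed_genideal A Y) A"
  unfolding closed_genideal_def using closed_ideal_carrier by (intro closed_ideal_Inter) auto

lemma closed_ideal_eq_carrier_if_one:
  "\<lbrakk>closed_ideal K A; \<one> \<in> K\<rbrakk> \<Longrightarrow> K = carrier A"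
  using closed_idealD(1,7)[of K A] r_one by fastforce

text \<open>This takes the place of inverting k by a Neumann series. For k and k' in K the element k
  + k' - kk' of K satisfies 1 - (k + k' - kk') = (1 - k)(1 - k'). Iteration gives elements of K
  within r^n of 1, and K is closed.\<close>

lemma closed_ideal_eq_carrier_if_near_one:
  assumes K: "closed_ideal K A" and k: "k \<in> K" "nrm A (\<one> \<ominus> k) < 1"
  shows "K = carrier A"
proof -
  note I = closed_idealD[OF K]
  define r where "r = nrm A (\<one> \<ominus> k)"
  have r: "0 \<le> r" "r < 1" using k I(2) by (auto simp: r_def)
  have "\<exists>k'\<in>K. nrm A (\<one> \<ominus> k') \<le> r ^ n" for n
  proof (induction n)
    case 0
    show ?case using norm_one_le I(3) by (intro bexI[of _ \<zero>]) auto
  next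
    case (Suc n)
    then obtain k' where k': "k' \<in> K" "nrm A (\<one> \<ominus> k') \<le> r ^ n" by auto
    have c: "k \<in> carrier A" "k' \<in> carrier A" using k k' I(2) by auto
    have "\<one> \<ominus> (k \<oplus> k' \<ominus> k \<otimes> k') = (\<one> \<ominus> k) \<otimes> (\<one> \<ominus> k')"
      using c by (simp add: minus_eq l_distr r_distr l_minus r_minus minus_add a_ac)
    then have "nrm A (\<one> \<ominus> (k \<oplus> k' \<ominus> k \<otimes> k')) \<le> r * r ^ n"
      using norm_mult[of "\<one> \<ominus> k" "\<one> \<ominus> k'"] mult_left_mono[OF k'(2) r(1)] c
      by (simp add: r_def)
    then show ?case using k(1) k'(1) c I by (intro bexI[of _ "k \<oplus> k' \<ominus> k \<otimes> k'"]) auto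
  qed
  then have "\<exists>k'\<in>K. nrm A (\<one> \<ominus> k') < e" if "e > 0" for e
    using real_arch_pow_inv[OF that r(2)] by (meson order_le_less_trans)
  then have "\<one> \<in> K"
    using closed_ideal_closed[OF K] by simp
  then show ?thesis using closed_ideal_eq_carrier_if_one K by simp
qed

text \<open>
  For \<open>\<parallel>x\<parallel> < 1\<close> put \<open>k = x x\<^sup>*\<close> and \<open>w = 1 - k\<^sup>2\<close>.  The Cesaro means \<open>e\<close> of the powers of \<open>w\<close>
  satisfy \<open>1 - e \<in> K\<close>, while \<open>k\<^sup>2 e\<close> telescopes to something of norm \<open>O(1/n)\<close>, so that
  \<open>x\<^sup>*(1 - e)\<close> tends to \<open>x\<^sup>*\<close>.
\<close>

lemma closed_ideal_star:
  assumes K: "closed_ideal K A" and x: "x \<in> K"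
  shows "star A x \<in> K"
proof -
  note I = closed_idealD[OF K]
  have contr: "star A x \<in> K" if x: "x \<in> K" "nrm A x < 1" for x
  proof -
    define k where "k = x \<otimes> star A x"
    have xc: "x \<in> carrier A" using x I by auto
    have k: "k \<in> carrier A" "star A k = k" "k \<in> K"
      using x xc I by (auto simp: k_def star_mult)
    have "nrm A k \<le> nrm A x * nrm A x"
      using norm_mult[of x "star A x"] xc by (simp add: k_def)
    also have "\<dots> < 1"
      using x(2) xc abs_square_less_1[of "nrm A x"] by (simp add: power2_eq_square)
    finally have "nrm A k < 1" .
    then obtain c where c: "c \<in> carrier A" "star A c = c" "c \<otimes> k = k \<otimes> c" "k \<otimes> k \<oplus> c \<otimes> c = \<one>"
      using sqrt_one_minus_square[of k] k by auto
    define w where "w = c \<otimes> c"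
    \<comment> \<open>The two squares exchange roles: the bound is applied to c with partner k. It
      yields ||w|| <= 1 without any order on the algebra.\<close>
    have "nrm A c \<le> 1"
      using norm_le_1_if_squares_add_up[of c k] c k a_comm[of "k \<otimes> k" "c \<otimes> c"] by simp
    then have w: "w \<in> carrier A" "star A w = w" "nrm A w \<le> 1"
      using c norm_mult[of c c] mult_le_one[of "nrm A c" "nrm A c"] by (auto simp: w_def star_mult)
    have wk: "w \<otimes> k = k \<otimes> w"
      using c k by (simp add: w_def) (metis m_assoc)
    have kk: "k \<otimes> k = \<one> \<ominus> w"
      using c k w by (simp add: w_def[symmetric] minus_eq flip: c(4)) (simp add: a_assoc r_neg)
    \<comment> \<open>S is the sum of the w^i for i < n, and p is w^n. Since k^2 = 1 - w, the
      product k^2 S telescopes to 1 - w^n, while n1 - S is the sum of the elements 1 - w^i of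
      K.\<close>
    have means: "\<exists>S\<in>carrier A. \<exists>p\<in>carrier A. star A S = S \<and> star A p = p \<and> S \<otimes> k = k \<otimes> S \<and>
        p \<otimes> k = k \<otimes> p \<and> p \<otimes> w = w \<otimes> p \<and> nrm A p \<le> 1 \<and> nrm A S \<le> real n \<and>
        k \<otimes> k \<otimes> S = \<one> \<ominus> p \<and> of_nat n \<odot> \<one> \<ominus> S \<in> K \<and> \<one> \<ominus> p \<in> K" for n
    proof (induction n)
      case 0
      show ?case
        using norm_one_le k I(3) w by (intro bexI[of _ \<zero>] bexI[of _ \<one>]) auto
    next
      case (Suc n)
      then obtain S p where S: "S \<in> carrier A" "star A S = S" "S \<otimes> k = k \<otimes> S" "nrm A S \<le> real n"
        and p: "p \<in> carrier A" "star A p = p" "p \<otimes> k = k \<otimes> p" "p \<otimes> w = w \<otimes> p" "nrm A p \<le> 1"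
        and kkS: "k \<otimes> k \<otimes> S = \<one> \<ominus> p"
        and mem: "of_nat n \<odot> \<one> \<ominus> S \<in> K" "\<one> \<ominus> p \<in> K" by blast
      have "k \<otimes> k \<otimes> (S \<oplus> p) = (\<one> \<ominus> p) \<oplus> (\<one> \<ominus> w) \<otimes> p"
        using S p k by (simp add: r_distr kkS) (simp add: kk)
      also have "\<dots> = \<one> \<ominus> p \<otimes> w"
        using p w by (simp add: mult_diff_left diff_add_diff)
      finally have 1: "k \<otimes> k \<otimes> (S \<oplus> p) = \<one> \<ominus> p \<otimes> w" .
      have "of_nat (Suc n) \<odot> \<one> \<ominus> (S \<oplus> p) = (of_nat n \<odot> \<one> \<ominus> S) \<oplus> (\<one> \<ominus> p)"
        using S p by (simp add: smult_add_left add_diff_add[symmetric] a_comm)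
      then have 2: "of_nat (Suc n) \<odot> \<one> \<ominus> (S \<oplus> p) \<in> K"
        using mem I(4) by simp
      have "\<one> \<ominus> p \<otimes> w = (\<one> \<ominus> p) \<otimes> w \<oplus> k \<otimes> k"
        using p w diff_add_diff[of \<one> w "p \<otimes> w"] by (simp add: kk mult_diff_left a_comm)
      then have 3: "\<one> \<ominus> p \<otimes> w \<in> K"
        using mem I k w by simp
      have 4: "p \<otimes> w \<otimes> k = k \<otimes> (p \<otimes> w)" "p \<otimes> w \<otimes> w = w \<otimes> (p \<otimes> w)"
        using p w k wk by (metis m_assoc)+
      have 5: "nrm A (p \<otimes> w) \<le> 1"
        using norm_mult[of p w] p w mult_le_one[of "nrm A p" "nrm A w"] by auto
      have 6: "nrm A (S \<oplus> p) \<le> real (Suc n)"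
        using norm_triangle[of S p] S p by simp
      have 7: "star A (p \<otimes> w) = p \<otimes> w" "star A (S \<oplus> p) = S \<oplus> p"
        using S(1,2) p(1,2,4) w(1,2) by (simp_all add: star_mult star_add)
      have 8: "(S \<oplus> p) \<otimes> k = k \<otimes> (S \<oplus> p)"
        using S(1,3) p(1,3) k(1) by (simp add: l_distr r_distr)
      show ?case
        by (intro bexI[of _ "S \<oplus> p"] bexI[of _ "p \<otimes> w"] conjI 1 2 3 4 5 6 7 8
            a_closed m_closed S(1) p(1) w(1))
    qed
    show ?thesis
    proof (rule closed_ideal_closed[OF K])
      fix \<epsilon> :: real assume eps: "\<epsilon> > 0"
      \<comment> \<open>Two uses of the C*-identity will give ||star x e||^4 <= ||ke||^2 <= ||k^2
        e|| <= 2/n, hence the fourth power.\<close>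
      obtain n where n: "n > 0" "2 / real n < \<epsilon> ^ 4"
      proof -
        obtain n where n: "2 / \<epsilon> ^ 4 < real n" using reals_Archimedean2 by blast
        moreover have "0 < 2 / \<epsilon> ^ 4" using eps by simp
        ultimately have "n > 0" by (cases n) auto
        then show ?thesis using n eps that[of n] by (simp add: field_simps)
      qed
      obtain S p where S: "S \<in> carrier A" "star A S = S" "S \<otimes> k = k \<otimes> S" "nrm A S \<le> real n"
        and p: "p \<in> carrier A" "nrm A p \<le> 1"
        and kkS: "k \<otimes> k \<otimes> S = \<one> \<ominus> p"
        and mem: "of_nat n \<odot> \<one> \<ominus> S \<in> K" using means[of n] by blast
      define e where "e = (1 / of_nat n) \<odot> S"
      have e: "e \<in> carrier A" "star A e = e" "e \<otimes> k = k \<otimes> e" "nrm A e \<le> 1"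
        using S k n by (auto simp: e_def star_smult smult_mult_left smult_mult_right norm_smult norm_divide)
      have mem': "\<one> \<ominus> e \<in> K"
      proof -
        have "\<one> \<ominus> e = (1 / of_nat n) \<odot> (of_nat n \<odot> \<one> \<ominus> S)"
          using S n by (simp add: e_def smult_diff_right smult_smult)
        then show ?thesis using mem closed_ideal_smult[OF K] by simp
      qed
      have 1: "nrm A (k \<otimes> k \<otimes> e) \<le> 2 / real n"
      proof -
        have "k \<otimes> k \<otimes> e = (1 / of_nat n) \<odot> (\<one> \<ominus> p)"
          using S k by (simp add: e_def smult_mult_right kkS)
        then show ?thesis
          using norm_diff_le[of \<one> p] norm_one_le p n
          by (simp add: norm_smult norm_divide divide_right_mono)
      qed
      have "(nrm A (k \<otimes> e))\<^sup>2 = nrm A (k \<otimes> k \<otimes> e \<otimes> e)"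
      proof -
        have "star A (k \<otimes> e) \<otimes> (k \<otimes> e) = k \<otimes> k \<otimes> e \<otimes> e"
          using k e by (simp add: star_mult) (metis e(3) k(1) m_assoc m_closed)
        then show ?thesis using cstar_identity[of "k \<otimes> e"] k e by simp
      qed
      also have "\<dots> \<le> nrm A (k \<otimes> k \<otimes> e)"
        using norm_mult[of "k \<otimes> k \<otimes> e" e] e k mult_left_le[of "nrm A e" "nrm A (k \<otimes> k \<otimes> e)"] by simp
      finally have 2: "(nrm A (k \<otimes> e))\<^sup>2 \<le> 2 / real n" using 1 by simp
      have "(nrm A (star A x \<otimes> e))\<^sup>2 = nrm A (k \<otimes> e \<otimes> e)"
      proof -
        have "star A (star A x \<otimes> e) \<otimes> (star A x \<otimes> e) = e \<otimes> (x \<otimes> star A x) \<otimes> e"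
          using xc e by (simp add: star_mult m_assoc)
        then show ?thesis using cstar_identity[of "star A x \<otimes> e"] xc e by (simp add: k_def[symmetric])
      qed
      also have "\<dots> \<le> nrm A (k \<otimes> e)"
        using norm_mult[of "k \<otimes> e" e] e k mult_left_le[of "nrm A e" "nrm A (k \<otimes> e)"] by simp
      finally have "((nrm A (star A x \<otimes> e))\<^sup>2)\<^sup>2 \<le> (nrm A (k \<otimes> e))\<^sup>2"
        by (intro power_mono) auto
      then have "(nrm A (star A x \<otimes> e)) ^ 4 < \<epsilon> ^ 4"
        using 2 n(2) by (simp flip: power_mult)
      then have small: "nrm A (star A x \<otimes> e) < \<epsilon>"
        using eps power_less_imp_less_base[of _ 4 \<epsilon>] by auto
      have "star A x \<ominus> star A x \<otimes> (\<one> \<ominus> e) = star A x \<otimes> e"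
        using xc e by (simp add: mult_diff_right) (simp add: minus_eq minus_add a_ac r_neg1 r_neg2 r_neg)
      then show "\<exists>k\<in>K. nrm A (star A x \<ominus> k) < \<epsilon>"
        using small mem' xc I(7)[of "\<one> \<ominus> e" "star A x"] by (intro bexI[of _ "star A x \<otimes> (\<one> \<ominus> e)"]) auto
    qed (use xc in auto)
  qed
  \<comment> \<open>Division by ||x|| + 1 brings the norm below 1 and is also legitimate for x =
    0.\<close>
  define t where "t = complex_of_real (nrm A x + 1)"
  have xc: "x \<in> carrier A" using x I by auto
  then have t: "cmod t = nrm A x + 1" "t \<noteq> 0" "cnj t = t"
    using norm_nonneg[of x] unfolding t_def by (auto simp: norm_of_real simp del: of_real_add norm_nonneg)
  have "star A ((1 / t) \<odot> x) \<in> K"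
    using x xc t norm_nonneg[OF xc]
    by (intro contr closed_ideal_smult[OF K]) (auto simp: norm_smult norm_divide divide_less_eq simp del: norm_nonneg)
  then have "t \<odot> star A ((1 / t) \<odot> x) \<in> K"
    using closed_ideal_smult[OF K] by simp
  then show ?thesis using xc t by (simp add: star_smult smult_smult)
qed

end

text \<open>Contractivity of \<phi> makes the preimage closed. The case of the zero ideal covers
  kernels.\<close>

lemma closed_ideal_vimage:
  assumes hom: "\<phi> \<in> star_hom A B" and A: "cstar_alg A" and B: "cstar_alg B" and L: "closed_ideal L B"
  shows "closed_ideal {x \<in> carrier A. \<phi> x \<in> L} A"
proof -
  interpret A: cstar_alg A by fact
  interpret B: cstar_alg B by fact
  note h = star_homD[OF hom] and I = closed_idealD[OF L]
  show ?thesis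
  proof (rule A.closed_idealI)
    fix x assume x: "x \<in> carrier A"
      and lim: "\<And>e. e > 0 \<Longrightarrow> \<exists>k\<in>{x \<in> carrier A. \<phi> x \<in> L}. nrm A (x \<ominus>\<^bsub>A\<^esub> k) < e"
    have "\<phi> x \<in> L"
    proof (rule B.closed_ideal_closed[OF L])
      fix e :: real assume "e > 0"
      then obtain k where k: "k \<in> carrier A" "\<phi> k \<in> L" "nrm A (x \<ominus>\<^bsub>A\<^esub> k) < e" using lim by blast
      then show "\<exists>k\<in>L. nrm B (\<phi> x \<ominus>\<^bsub>B\<^esub> k) < e"
        using star_hom_contractive[OF hom A B, of "x \<ominus>\<^bsub>A\<^esub> k"] star_hom_diff[OF hom A B] x
        by (intro bexI[of _ "\<phi> k"]) auto
    qed (use x h in auto)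
    then show "x \<in> {x \<in> carrier A. \<phi> x \<in> L}" using x by simp
  qed (auto simp: h star_hom_zero[OF hom A B] intro: I)
qed

section \<open>Quotients\<close>

text \<open>The locale develops the ring and the metric of A/J. Where A/J has to be a C*-algebra,
  this comes from the hypothesis that a reduced crossed product of the quotient system is
  given.\<close>

locale cstar_quotient = cstar_alg +
  fixes J assumes J: "closed_ideal J A"
begin

abbreviation q where "q x \<equiv> J +> x"
abbreviation B where "B \<equiv> cstar_quot A J"

lemma ideal_J: "ideal J A"
  using J by (simp add: closed_ideal_def)

sublocale J: ideal J A by (rule ideal_J)

lemmas J_mem = closed_idealD[OF J]

lemma quot_simps:
  "carrier B = carrier (A Quot J)" "U \<otimes>\<^bsub>B\<^esub> V = U \<otimes>\<^bsub>A Quot J\<^esub> V" "U \<oplus>\<^bsub>B\<^esub> V = U \<oplus>\<^bsub>A Quot J\<^esub> V"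
  "\<one>\<^bsub>B\<^esub> = \<one>\<^bsub>A Quot J\<^esub>" "\<zero>\<^bsub>B\<^esub> = \<zero>\<^bsub>A Quot J\<^esub>"
  by (simp_all add: cstar_quot_def)

lemma carrier_quot: "carrier B = q ` carrier A"
  by (auto simp: quot_simps FactRing_simps)

lemma quot_hom: "q \<in> ring_hom A B"
  using J.rcos_ring_hom by (auto simp: ring_hom_def quot_simps)

lemma q_closed: "x \<in> carrier A \<Longrightarrow> q x \<in> carrier B"
  by (simp add: carrier_quot)

lemma q_mult: "\<lbrakk>x \<in> carrier A; y \<in> carrier A\<rbrakk> \<Longrightarrow> q x \<otimes>\<^bsub>B\<^esub> q y = q (x \<otimes> y)"
  using quot_hom by (simp add: ring_hom_def)

lemma q_add: "\<lbrakk>x \<in> carrier A; y \<in> carrier A\<rbrakk> \<Longrightarrow> q x \<oplus>\<^bsub>B\<^esub> q y = q (x \<oplus> y)"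
  using quot_hom by (simp add: ring_hom_def)

lemma ring_quot: "ring B"
proof -
  interpret Q: ring "A Quot J" by (rule J.quotient_is_ring)
  show ?thesis
    by (intro ringI abelian_groupI monoidI)
      (auto simp: quot_simps Q.a_ac Q.m_assoc Q.l_distr Q.r_distr intro: Q.add.l_inv_ex[simplified])
qed

sublocale Q: ring B by (rule ring_quot)

lemma q_minus: "x \<in> carrier A \<Longrightarrow> \<ominus>\<^bsub>B\<^esub> q x = q (\<ominus> x)"
proof -
  interpret ring_hom_ring A B q
    using quot_hom by (intro ring_hom_ringI2 ring_axioms Q.ring_axioms)
  show "x \<in> carrier A \<Longrightarrow> \<ominus>\<^bsub>B\<^esub> q x = q (\<ominus> x)" by simp
qed

lemma q_diff: "\<lbrakk>x \<in> carrier A; y \<in> carrier A\<rbrakk> \<Longrightarrow> q x \<ominus>\<^bsub>B\<^esub> q y = q (x \<ominus> y)"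
  by (simp add: a_minus_def q_minus q_add)

lemma q_eq: "\<lbrakk>x \<in> carrier A; y \<in> carrier A\<rbrakk> \<Longrightarrow> q x = q y \<longleftrightarrow> x \<ominus> y \<in> J"
  using quotient_eq_iff_same_a_r_cos[OF ideal_J] by blast

lemma zero_quot: "\<zero>\<^bsub>B\<^esub> = q \<zero>"
  using quot_hom Q.ring_axioms ring_axioms by (metis ring_hom_zero)

lemma q_eq_zero: "x \<in> carrier A \<Longrightarrow> q x = \<zero>\<^bsub>B\<^esub> \<longleftrightarrow> x \<in> J"
  by (simp add: zero_quot q_eq)

lemma mem_q: "x \<in> carrier A \<Longrightarrow> y \<in> q x \<longleftrightarrow> (\<exists>k\<in>J. y = k \<oplus> x)"
  by (auto simp: a_r_coset_def r_coset_def)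

lemma self_mem_q: "x \<in> carrier A \<Longrightarrow> x \<in> q x"
  using J_mem(3) by (auto simp: mem_q intro!: bexI[of _ \<zero>])

text \<open>The operation on cosets is defined as a union over all representatives; it collapses to
  a single coset because J absorbs scalars.\<close>

lemma q_smult:
  assumes x: "x \<in> carrier A" shows "smult B c (q x) = q (c \<odot> x)"
proof -
  have "q (c \<odot> y) = q (c \<odot> x)" if "y \<in> q x" for y
  proof -
    obtain k where k: "k \<in> J" "y = k \<oplus> x" using \<open>y \<in> q x\<close> x by (auto simp: mem_q)
    have kc: "k \<in> carrier A" using k J_mem(2) by simp
    have "c \<odot> y \<ominus> c \<odot> x = c \<odot> k"
      using k kc x by (simp add: smult_add_right minus_eq a_assoc r_neg)
    then show ?thesis
      using k kc x closed_ideal_smult[OF J k(1)] by (subst q_eq) auto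
  qed
  then have "(\<Union>y\<in>q x. q (c \<odot> y)) = q (c \<odot> x)"
    using self_mem_q[OF x] by (intro SUP_eq_const) blast+
  then show ?thesis by (simp add: cstar_quot_def)
qed

text \<open>Independence of the representative is where self-adjointness of closed ideals is
  used.\<close>

lemma q_star:
  assumes x: "x \<in> carrier A" shows "star B (q x) = q (star A x)"
proof -
  have "q (star A y) = q (star A x)" if "y \<in> q x" for y
  proof -
    obtain k where k: "k \<in> J" "y = k \<oplus> x" using \<open>y \<in> q x\<close> x by (auto simp: mem_q)
    have kc: "k \<in> carrier A" using k J_mem(2) by simp
    have "star A y \<ominus> star A x = star A k"
      using k kc x by (simp add: star_add minus_eq a_assoc r_neg)
    then show ?thesis
      using k kc x closed_ideal_star[OF J k(1)] by (subst q_eq) auto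
  qed
  then have "(\<Union>y\<in>q x. q (star A y)) = q (star A x)"
    using self_mem_q[OF x] by (intro SUP_eq_const) blast+
  then show ?thesis by (simp add: cstar_quot_def)
qed

section \<open>The quotient norm and ideals of the quotient\<close>

lemma nrm_q: "nrm B U = Inf (nrm A ` U)"
  by (simp add: cstar_quot_def)

lemma nrm_q_bdd: "x \<in> carrier A \<Longrightarrow> bdd_below (nrm A ` q x)"
  using J_mem(2) by (auto simp: mem_q intro!: bdd_belowI[of _ 0])

lemma nrm_q_le: assumes "x \<in> carrier A" "k \<in> J" shows "nrm B (q x) \<le> nrm A (k \<oplus> x)"
  unfolding nrm_q using assms nrm_q_bdd by (intro cInf_lower) (auto simp: mem_q)

lemma nrm_q_le_nrm: "x \<in> carrier A \<Longrightarrow> nrm B (q x) \<le> nrm A x"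
  using nrm_q_le[of x \<zero>] J_mem(3) by simp

lemma nrm_q_ex:
  assumes "x \<in> carrier A" "nrm B (q x) < r" shows "\<exists>k\<in>J. nrm A (k \<oplus> x) < r"
proof -
  have "q x \<noteq> {}" using self_mem_q[OF assms(1)] by blast
  then have "\<exists>y\<in>nrm A ` q x. y < r"
    using assms(2) nrm_q_bdd[OF assms(1)] cInf_less_iff[of "nrm A ` q x" r] by (simp add: nrm_q)
  then show ?thesis using assms(1) by (auto simp: mem_q)
qed

lemma nrm_q_nonneg: "x \<in> carrier A \<Longrightarrow> 0 \<le> nrm B (q x)"
  using nrm_q_ex[of x 0] J_mem(2) norm_nonneg a_closed by (meson leI not_le)

text \<open>Facts about \<open>cstar_topology\<close> of the quotient are available only once its
  distance is a metric. Closedness of J separates points, and the triangle inequality follows from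
  representatives that are optimal up to e/2.\<close>

lemma metric_quot: "Metric_space (carrier B) (cstar_dist B)"
proof
  fix U V
  show "0 \<le> cstar_dist B U V"
    by (auto simp: cstar_dist_def carrier_quot q_diff nrm_q_nonneg)
  have minus: "nrm B (q (x \<ominus> y)) \<le> nrm B (q (y \<ominus> x))" if "x \<in> carrier A" "y \<in> carrier A" for x y
  proof (rule dense_ge)
    fix r assume "nrm B (q (y \<ominus> x)) < r"
    then obtain k where k: "k \<in> J" "nrm A (k \<oplus> (y \<ominus> x)) < r"
      using nrm_q_ex[OF minus_closed[OF \<open>y \<in> carrier A\<close> \<open>x \<in> carrier A\<close>]] by blast
    have "\<ominus> (k \<oplus> (y \<ominus> x)) = \<ominus> k \<oplus> (x \<ominus> y)"
      using k that J_mem(2) by (simp add: minus_add minus_diff)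
    then have "nrm A (\<ominus> k \<oplus> (x \<ominus> y)) < r"
      using k that J_mem(2) by (metis a_closed minus_closed norm_minus)
    then show "nrm B (q (x \<ominus> y)) \<le> r"
      using nrm_q_le[of "x \<ominus> y" "\<ominus> k"] that k by force
  qed
  show "cstar_dist B U V = cstar_dist B V U"
    by (auto simp: cstar_dist_def carrier_quot q_diff intro!: antisym minus)
  fix W
  show "cstar_dist B U V = 0 \<longleftrightarrow> U = V" if UV: "U \<in> carrier B" "V \<in> carrier B"
  proof -
    obtain x y where x: "x \<in> carrier A" "U = q x" and y: "y \<in> carrier A" "V = q y"
      using UV by (auto simp: carrier_quot)
    have "x \<ominus> y \<in> J" if 0: "nrm B (q (x \<ominus> y)) = 0"
    proof (rule closed_ideal_closed[OF J])
      fix e :: real assume "e > 0"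
      then obtain k where k: "k \<in> J" "nrm A (k \<oplus> (x \<ominus> y)) < e"
        using nrm_q_ex[of "x \<ominus> y" e] 0 x y by auto
      then have "nrm A ((x \<ominus> y) \<ominus> (\<ominus> k)) < e" "\<ominus> k \<in> J"
        using x y J_mem(2) by (simp_all add: minus_eq a_ac)
      then show "\<exists>k\<in>J. nrm A (x \<ominus> y \<ominus> k) < e" by blast
    qed (use x y in simp)
    moreover have "nrm B (q (x \<ominus> y)) = 0" if "U = V"
    proof -
      have "y \<ominus> x \<in> J" using that x y q_eq[of y x] by auto
      then have "nrm B (q (x \<ominus> y)) \<le> 0"
        using nrm_q_le[of "x \<ominus> y" "y \<ominus> x"] x y by (simp add: diff_add_diff)
      then show ?thesis using nrm_q_nonneg[of "x \<ominus> y"] x y by simp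
    qed
    ultimately show ?thesis
      using x y by (auto simp: cstar_dist_def q_closed q_diff q_eq)
  qed
  show "cstar_dist B U W \<le> cstar_dist B U V + cstar_dist B V W"
    if UVW: "U \<in> carrier B" "V \<in> carrier B" "W \<in> carrier B"
  proof -
    obtain x y z where x: "x \<in> carrier A" "U = q x" and y: "y \<in> carrier A" "V = q y"
      and z: "z \<in> carrier A" "W = q z"
      using UVW by (auto simp: carrier_quot)
    have "nrm B (q (x \<ominus> z)) \<le> nrm B (q (x \<ominus> y)) + nrm B (q (y \<ominus> z))"
    proof (rule field_le_epsilon)
      fix e :: real assume e: "e > 0"
      obtain k where k: "k \<in> J" "nrm A (k \<oplus> (x \<ominus> y)) < nrm B (q (x \<ominus> y)) + e / 2"
        using nrm_q_ex[of "x \<ominus> y" "nrm B (q (x \<ominus> y)) + e / 2"] x y e by auto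
      obtain l where l: "l \<in> J" "nrm A (l \<oplus> (y \<ominus> z)) < nrm B (q (y \<ominus> z)) + e / 2"
        using nrm_q_ex[of "y \<ominus> z" "nrm B (q (y \<ominus> z)) + e / 2"] z y e by auto
      have c: "k \<in> carrier A" "l \<in> carrier A" using k l J_mem(2) by auto
      have "(k \<oplus> (x \<ominus> y)) \<oplus> (l \<oplus> (y \<ominus> z)) = (k \<oplus> l) \<oplus> ((x \<ominus> y) \<oplus> (y \<ominus> z))"
        using c x y z by (simp add: a_ac)
      also have "\<dots> = (k \<oplus> l) \<oplus> (x \<ominus> z)"
        using x y z by (simp add: diff_add_diff)
      finally have "nrm A ((k \<oplus> l) \<oplus> (x \<ominus> z)) \<le> nrm A (k \<oplus> (x \<ominus> y)) + nrm A (l \<oplus> (y \<ominus> z))"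
        using norm_triangle[of "k \<oplus> (x \<ominus> y)" "l \<oplus> (y \<ominus> z)"] c x y z by simp
      then show "nrm B (q (x \<ominus> z)) \<le> nrm B (q (x \<ominus> y)) + nrm B (q (y \<ominus> z)) + e"
        using nrm_q_le[of "x \<ominus> z" "k \<oplus> l"] J_mem(4)[OF k(1) l(1)] k l x z by simp
    qed
    then show ?thesis
      using x y z by (simp add: cstar_dist_def q_closed q_diff)
  qed
qed

text \<open>Closedness survives because a correction k in J of x - m can be absorbed: k + (x - m) =
  x - (m - k), and m - k lies in M. So q(x) is no closer to q(M) than x is to M.\<close>

lemma closed_ideal_image:
  assumes M: "closed_ideal M A" "J \<subseteq> M"
  shows "closed_ideal (q ` M) B"
proof -
  note I = closed_idealD[OF M(1)]
  have mem: "x \<in> M" if "q x \<in> q ` M" "x \<in> carrier A" for x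
  proof -
    obtain m where m: "m \<in> M" "q x = q m" using \<open>q x \<in> q ` M\<close> by blast
    then have "x \<ominus> m \<in> M" using that q_eq I(2) M(2) by blast
    then have "(x \<ominus> m) \<oplus> m \<in> M" using m I(4) by blast
    then show ?thesis using that m I(2) by simp
  qed
  have neg: "\<ominus> x \<in> M" if "x \<in> M" for x
    using I(5)[OF I(3) that] I(2)[OF that] by (simp add: minus_eq)
  have "ideal (q ` M) B"
  proof (rule idealI[OF Q.ring_axioms])
    show "subgroup (q ` M) (add_monoid B)"
    proof (rule subgroup.intro)
      show "q ` M \<subseteq> carrier (add_monoid B)" using I(2) by (auto simp: q_closed)
      show "\<one>\<^bsub>add_monoid B\<^esub> \<in> q ` M" using I(3) by (simp add: zero_quot)
      show "x \<otimes>\<^bsub>add_monoid B\<^esub> y \<in> q ` M" if "x \<in> q ` M" "y \<in> q ` M" for x y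
        using that I(2,4) by (auto simp: q_add)
      show "inv\<^bsub>add_monoid B\<^esub> x \<in> q ` M" if "x \<in> q ` M" for x
        using that I(2) neg by (auto simp: q_minus a_inv_def[symmetric])
    qed
    fix U V assume "U \<in> q ` M" "V \<in> carrier B"
    then obtain x y where "x \<in> M" "U = q x" "y \<in> carrier A" "V = q y"
      by (auto simp: carrier_quot)
    then show "V \<otimes>\<^bsub>B\<^esub> U \<in> q ` M" "U \<otimes>\<^bsub>B\<^esub> V \<in> q ` M"
      using I(2,6,7) by (auto simp: q_mult)
  qed
  moreover have "closedin (cstar_topology B) (q ` M)"
  proof -
    interpret MB: Metric_space "carrier B" "cstar_dist B" by (rule metric_quot)
    show ?thesis
      unfolding MB.closedin_metric
    proof (intro conjI ballI allI impI)
      show "q ` M \<subseteq> carrier B" using I(2) by (auto simp: q_closed)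
      fix U assume U: "U \<in> carrier B - q ` M"
      then obtain x where x: "x \<in> carrier A" "U = q x" "x \<notin> M" by (auto simp: carrier_quot)
      then obtain e where e: "e > 0" "\<And>m. m \<in> M \<Longrightarrow> \<not> nrm A (x \<ominus> m) < e"
        using closed_ideal_closed[OF M(1) x(1)] by blast
      have "\<not> cstar_dist B U (q m) < e" if m: "m \<in> M" for m
      proof
        assume "cstar_dist B U (q m) < e"
        then have "nrm B (q (x \<ominus> m)) < e"
          using x m I(2) by (simp add: cstar_dist_def q_closed q_diff)
        then obtain k where k: "k \<in> J" "nrm A (k \<oplus> (x \<ominus> m)) < e"
          using nrm_q_ex[of "x \<ominus> m" e] x m I(2) by auto
        have "k \<oplus> (x \<ominus> m) = x \<ominus> (m \<ominus> k)"
          using k x m I(2) J_mem(2) by (simp add: minus_eq minus_add a_ac)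
        moreover have "m \<ominus> k \<in> M" using m k M(2) I(5) by blast
        ultimately show False using k e(2) by fastforce
      qed
      then show "\<exists>r>0. disjnt (q ` M) (MB.mball U r)"
        using e(1) by (auto simp: disjnt_iff)
    qed
  qed
  ultimately show ?thesis by (simp add: closed_ideal_def)
qed

text \<open>Turns an arbitrary simple quotient into a maximal ideal. An ideal M above J has image
  zero, which gives M = J, or its image is everything; then 1 - m lies in J for some m in M, so M
  contains 1.\<close>

lemma maximal_if_simple_quot:
  assumes "cstar_simple B"
  shows "J \<in> maximal_ideals A"
proof -
  have "J \<noteq> carrier A"
  proof
    assume "J = carrier A"
    then have "U = \<zero>\<^bsub>B\<^esub>" if "U \<in> carrier B" for U
      using that q_eq_zero unfolding carrier_quot by blast
    then have "carrier B = {\<zero>\<^bsub>B\<^esub>}" using Q.zero_closed by blast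
    then show False using assms by (simp add: cstar_simple_def)
  qed
  moreover have "M = J" if M: "closed_ideal M A" "M \<noteq> carrier A" "J \<subseteq> M" for M
  proof -
    note I = closed_idealD[OF M(1)]
    consider "q ` M = {\<zero>\<^bsub>B\<^esub>}" | "q ` M = carrier B"
      using assms closed_ideal_image[OF M(1,3)] unfolding cstar_simple_def by blast
    then show ?thesis
    proof cases
      case 1
      have "x \<in> J" if "x \<in> M" for x
        using 1 that q_eq_zero[OF I(2)[OF that]] by (metis imageI singletonD)
      then have "M \<subseteq> J" by blast
      then show ?thesis using M(3) by blast
    next
      case 2
      then obtain m where m: "m \<in> M" "q \<one> = q m"
        using q_closed[OF one_closed] by (metis imageE)
      then have "\<one> \<ominus> m \<in> M" using q_eq[of \<one> m] I(2)[of m] M(3) by auto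
      then have "(\<one> \<ominus> m) \<oplus> m \<in> M" using m I(4) by blast
      then have "\<one> \<in> M" using m I(2) by simp
      then show ?thesis using closed_ideal_eq_carrier_if_one[OF M(1)] M(2) by simp
    qed
  qed
  ultimately show ?thesis using J by (auto simp: maximal_ideals_def)
qed

end

text \<open>The isomorphism theorem for rings supplies the bijection; compatibility with scalars and
  adjoints is then checked on cosets.\<close>

lemma star_hom_quotient_iso:
  assumes hom: "\<pi> \<in> star_hom A B" and surj: "\<pi> ` carrier A = carrier B"
    and A: "cstar_alg A" and B: "cstar_alg B"
  defines "K \<equiv> a_kernel A B \<pi>"
  shows "\<exists>\<phi>\<in>star_iso (cstar_quot A K) B. \<forall>x\<in>carrier A. \<phi> (K +>\<^bsub>A\<^esub> x) = \<pi> x"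
proof -
  interpret A: cstar_alg A by fact
  interpret B: cstar_alg B by fact
  note h = star_homD[OF hom]
  have K: "closed_ideal K A"
    using closed_ideal_vimage[OF hom A B B.closed_ideal_singleton] by (simp add: K_def a_kernel_eq)
  interpret q: cstar_quotient A K by unfold_locales (rule K)
  interpret R: ring_hom_ring A B \<pi>
    using hom by (intro ring_hom_ringI2 A.ring_axioms B.ring_axioms) (simp add: star_hom_def)
  define \<phi> where "\<phi> = (\<lambda>U. the_elem (\<pi> ` U))"
  have \<phi>: "\<phi> (K +>\<^bsub>A\<^esub> x) = \<pi> x" if "x \<in> carrier A" for x
    using R.the_elem_simp[OF that] by (simp add: \<phi>_def K_def)
  have "\<phi> \<in> ring_iso (A Quot K) B"
    using R.FactRing_iso_set[OF surj] by (simp add: \<phi>_def K_def)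
  then have "\<phi> \<in> ring_hom (cstar_quot A K) B" "bij_betw \<phi> (carrier (cstar_quot A K)) (carrier B)"
    by (auto simp: ring_iso_def ring_hom_def q.quot_simps)
  then have "\<phi> \<in> star_iso (cstar_quot A K) B"
    using h by (auto simp: star_iso_def star_hom_def q.carrier_quot q.q_smult q.q_star \<phi>)
  then show ?thesis using \<phi> by blast
qed

section \<open>Closures and convex combinations\<close>

context cstar_alg
begin

abbreviation cl where "cl T \<equiv> cstar_topology A closure_of T"

lemma cl_carrier: "cl T \<subseteq> carrier A"
proof -
  interpret Metric_space "carrier A" "cstar_dist A" by (rule metric)
  show ?thesis using closure_of_subset_topspace[of mtopology] by simp
qed

lemma cl_subset: assumes "T \<subseteq> carrier A" shows "T \<subseteq> cl T"
proof -
  interpret Metric_space "carrier A" "cstar_dist A" by (rule metric)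
  show ?thesis using assms closure_of_subset[of T mtopology] by simp
qed

lemma cl_approx: "\<lbrakk>x \<in> cl T; T \<subseteq> carrier A; e > 0\<rbrakk> \<Longrightarrow> \<exists>t\<in>T. nrm A (x \<ominus> t) < e"
  by (simp add: closure_of_iff)

lemma cl_map:
  assumes x: "x \<in> cl T" and T: "T \<subseteq> carrier A" and U: "f ` T \<subseteq> U" "U \<subseteq> carrier A"
    and f: "f x \<in> carrier A" "0 \<le> C" "\<And>t. t \<in> T \<Longrightarrow> nrm A (f x \<ominus> f t) \<le> C * nrm A (x \<ominus> t)"
  shows "f x \<in> cl U"
  unfolding closure_of_iff[OF U(2)]
proof (intro conjI allI impI)
  fix e :: real assume "e > 0"
  \<comment> \<open>Using C + 1 keeps the divisor positive when C = 0.\<close>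
  then obtain t where t: "t \<in> T" "nrm A (x \<ominus> t) < e / (C + 1)"
    using cl_approx[OF x T, of "e / (C + 1)"] f(2) by auto
  have "x \<in> carrier A" "t \<in> carrier A" using x t T cl_carrier by blast+
  then have "C * nrm A (x \<ominus> t) \<le> (C + 1) * nrm A (x \<ominus> t)"
    by (intro mult_right_mono) auto
  also have "\<dots> < e" using t f(2) by (simp add: field_simps)
  finally show "\<exists>t\<in>U. nrm A (f x \<ominus> t) < e"
    using f(3)[OF t(1)] U t(1) by (intro bexI[of _ "f t"]) auto
qed (rule f)

lemma cl_add:
  assumes x: "x \<in> cl T" and y: "y \<in> cl T" and T: "T \<subseteq> carrier A"
    and add: "\<And>s t. \<lbrakk>s \<in> T; t \<in> T\<rbrakk> \<Longrightarrow> s \<oplus> t \<in> T"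
  shows "x \<oplus> y \<in> cl T"
  unfolding closure_of_iff[OF T]
proof (intro conjI allI impI)
  have xy: "x \<in> carrier A" "y \<in> carrier A" using x y cl_carrier by blast+
  then show "x \<oplus> y \<in> carrier A" by simp
  fix e :: real assume "e > 0"
  then obtain s t where st: "s \<in> T" "nrm A (x \<ominus> s) < e / 2" "t \<in> T" "nrm A (y \<ominus> t) < e / 2"
    using cl_approx[OF x T, of "e / 2"] cl_approx[OF y T, of "e / 2"] by auto
  then have "s \<in> carrier A" "t \<in> carrier A" using T by auto
  then have "nrm A (x \<oplus> y \<ominus> (s \<oplus> t)) < e"
    using norm_triangle[of "x \<ominus> s" "y \<ominus> t"] xy st by (simp add: add_diff_add)
  then show "\<exists>t\<in>T. nrm A (x \<oplus> y \<ominus> t) < e" using add st by blast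
qed

lemma cl_mult_right:
  assumes x: "x \<in> cl T" and T: "T \<subseteq> carrier A" and y: "y \<in> carrier A"
    and m: "\<And>s. s \<in> T \<Longrightarrow> s \<otimes> y \<in> U" and U: "U \<subseteq> carrier A"
  shows "x \<otimes> y \<in> cl U"
proof -
  have xc: "x \<in> carrier A" using x cl_carrier by blast
  show ?thesis
  proof (rule cl_map[OF x T _ U, of "\<lambda>x. x \<otimes> y" "nrm A y"])
    fix t assume "t \<in> T"
    then show "nrm A (x \<otimes> y \<ominus> t \<otimes> y) \<le> nrm A y * nrm A (x \<ominus> t)"
      using norm_mult[of "x \<ominus> t" y] xc y T by (auto simp: mult_diff_left mult.commute)
  qed (use m xc y in auto)
qed

lemma cl_mult_left:
  assumes x: "x \<in> cl T" and T: "T \<subseteq> carrier A" and y: "y \<in> carrier A"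
    and m: "\<And>s. s \<in> T \<Longrightarrow> y \<otimes> s \<in> U" and U: "U \<subseteq> carrier A"
  shows "y \<otimes> x \<in> cl U"
proof -
  have xc: "x \<in> carrier A" using x cl_carrier by blast
  show ?thesis
  proof (rule cl_map[OF x T _ U, of "\<lambda>x. y \<otimes> x" "nrm A y"])
    fix t assume "t \<in> T"
    then show "nrm A (y \<otimes> x \<ominus> y \<otimes> t) \<le> nrm A y * nrm A (x \<ominus> t)"
      using norm_mult[of y "x \<ominus> t"] xc y T by (auto simp: mult_diff_right)
  qed (use m xc y in auto)
qed

lemma closedin_cl: "closedin (cstar_topology A) (cl T)"
  by (rule closedin_closure_of)

text \<open>One factor at a time: multiplication by a fixed element is Lipschitz, so first sy is in
  the closure for s in T, and then xy is in the closure of the closure.\<close>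

lemma cl_mult:
  assumes x: "x \<in> cl T" and y: "y \<in> cl T" and T: "T \<subseteq> carrier A"
    and m: "\<And>s t. \<lbrakk>s \<in> T; t \<in> T\<rbrakk> \<Longrightarrow> s \<otimes> t \<in> T"
  shows "x \<otimes> y \<in> cl T"
proof -
  have "s \<otimes> y \<in> cl T" if "s \<in> T" for s
    using that T m by (intro cl_mult_left[OF y T]) auto
  then have "x \<otimes> y \<in> cl (cl T)"
    using y cl_carrier by (intro cl_mult_right[OF x T]) auto
  then show ?thesis by simp
qed

lemma closed_ideal_cl:
  assumes T: "T \<subseteq> carrier A" "\<zero> \<in> T" "\<And>s t. \<lbrakk>s \<in> T; t \<in> T\<rbrakk> \<Longrightarrow> s \<oplus> t \<in> T"
    "\<And>s x. \<lbrakk>s \<in> T; x \<in> carrier A\<rbrakk> \<Longrightarrow> s \<otimes> x \<in> T" "\<And>s x. \<lbrakk>s \<in> T; x \<in> carrier A\<rbrakk> \<Longrightarrow> x \<otimes> s \<in> T"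
  shows "closed_ideal (cl T) A"
proof (rule closed_idealI)
  show "\<zero> \<in> cl T" using cl_subset[OF T(1)] T(2) by blast
  show "x \<oplus> y \<in> cl T" if "x \<in> cl T" "y \<in> cl T" for x y
    using that T(1,3) by (rule cl_add)
  show "x \<otimes> y \<in> cl T" if "x \<in> cl T" "y \<in> carrier A" for x y
    using cl_mult_right[OF that(1) T(1) that(2) T(4)] that(2) T(1) by blast
  show "y \<otimes> x \<in> cl T" if "x \<in> cl T" "y \<in> carrier A" for x y
    using cl_mult_left[OF that(1) T(1) that(2) T(5)] that(2) T(1) by blast
  show "x \<in> cl T" if "x \<in> carrier A" "\<And>e. e > 0 \<Longrightarrow> \<exists>k\<in>cl T. nrm A (x \<ominus> k) < e" for x
    using that by (rule closedinD[OF closedin_cl])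
qed (rule cl_carrier)

text \<open>The two parts can be averaged separately, since K is a subspace and the ball of radius r
  about 1 is convex.\<close>

lemma convex_hull_near_one:
  assumes K: "closed_ideal K A"
    and Y: "\<And>w. w \<in> Y \<Longrightarrow> \<exists>k\<in>K. \<exists>b\<in>carrier A. w = k \<ominus> b \<and> nrm A (\<one> \<ominus> b) \<le> r"
    and z: "z \<in> cstar_convex_hull A Y"
  shows "\<exists>k\<in>K. \<exists>b\<in>carrier A. z = k \<ominus> b \<and> nrm A (\<one> \<ominus> b) \<le> r"
proof -
  note I = closed_idealD[OF K]
  obtain n :: nat and t x where tx: "\<forall>i<n. 0 \<le> t i \<and> x i \<in> Y" "(\<Sum>i<n. t i) = 1"
    and z: "z = (\<Oplus>i\<in>{..<n}. complex_of_real (t i) \<odot> x i)"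
    using z unfolding cstar_convex_hull_def by blast
  \<comment> \<open>The weights of a partial sum need not add up to 1, so the centre 1 and the
    radius r are both scaled by their sum.\<close>
  have "\<exists>k\<in>K. \<exists>b\<in>carrier A. (\<Oplus>i\<in>{..<m}. complex_of_real (t i) \<odot> x i) = k \<ominus> b \<and>
      nrm A (complex_of_real (\<Sum>i<m. t i) \<odot> \<one> \<ominus> b) \<le> (\<Sum>i<m. t i) * r" if "m \<le> n" for m
    using that
  proof (induction m)
    case 0
    show ?case using I(3) by (intro bexI[of _ \<zero>]) auto
  next
    case (Suc m)
    define s where "s = (\<Sum>i<m. t i)"
    obtain k b where kb: "k \<in> K" "b \<in> carrier A"
      "(\<Oplus>i\<in>{..<m}. complex_of_real (t i) \<odot> x i) = k \<ominus> b"
      "nrm A (complex_of_real s \<odot> \<one> \<ominus> b) \<le> s * r"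
      using Suc.IH Suc.prems by (auto simp: s_def)
    have tm: "0 \<le> t m" "x m \<in> Y" using Suc.prems tx by auto
    obtain l c where lc: "l \<in> K" "c \<in> carrier A" "x m = l \<ominus> c" "nrm A (\<one> \<ominus> c) \<le> r"
      using Y[OF tm(2)] by blast
    have car: "k \<in> carrier A" "l \<in> carrier A" using kb lc I(2) by auto
    have xc: "x i \<in> carrier A" if "i < n" for i
    proof -
      have "x i \<in> Y" using tx that by blast
      then obtain k' b' where "k' \<in> K" "b' \<in> carrier A" "x i = k' \<ominus> b'"
        using Y by blast
      then show ?thesis using I(2) by simp
    qed
    let ?t = "complex_of_real (t m)"
    have "(\<Oplus>i\<in>{..<Suc m}. complex_of_real (t i) \<odot> x i) = ?t \<odot> x m \<oplus> (k \<ominus> b)"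
      using Suc.prems xc by (subst lessThan_Suc, subst finsum_insert) (auto simp: kb)
    also have "\<dots> = (?t \<odot> l \<oplus> k) \<ominus> (?t \<odot> c \<oplus> b)"
      using kb(1,2) lc(1,2) car by (simp add: lc(3) smult_diff_right add_diff_add)
    finally have 1: "(\<Oplus>i\<in>{..<Suc m}. complex_of_real (t i) \<odot> x i) = (?t \<odot> l \<oplus> k) \<ominus> (?t \<odot> c \<oplus> b)" .
    have 2: "?t \<odot> l \<oplus> k \<in> K" using closed_ideal_smult[OF K lc(1)] kb(1) I(4) by blast
    have "complex_of_real (\<Sum>i<Suc m. t i) \<odot> \<one> = ?t \<odot> \<one> \<oplus> complex_of_real s \<odot> \<one>"
      by (simp add: s_def smult_add_left a_comm)
    then have "complex_of_real (\<Sum>i<Suc m. t i) \<odot> \<one> \<ominus> (?t \<odot> c \<oplus> b) =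
        ?t \<odot> (\<one> \<ominus> c) \<oplus> (complex_of_real s \<odot> \<one> \<ominus> b)"
      using kb(2) lc(2) by (simp add: smult_diff_right add_diff_add)
    moreover have "nrm A \<dots> \<le> t m * r + s * r"
      using norm_triangle[of "?t \<odot> (\<one> \<ominus> c)" "complex_of_real s \<odot> \<one> \<ominus> b"] kb(2,4) lc(2,4) tm(1)
        mult_left_mono[OF lc(4) tm(1)]
      by (simp add: norm_smult)
    ultimately have 3: "nrm A (complex_of_real (\<Sum>i<Suc m. t i) \<odot> \<one> \<ominus> (?t \<odot> c \<oplus> b)) \<le> (\<Sum>i<Suc m. t i) * r"
      by (simp add: s_def algebra_simps)
    show ?case
      using 1 2 3 kb(2) lc(2) by (intro bexI[of _ "?t \<odot> l \<oplus> k"] bexI[of _ "?t \<odot> c \<oplus> b"] conjI) auto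
  qed
  from this[of n] show ?thesis using tx(2) z by simp
qed

end

section \<open>The expectation of a crossed product\<close>

locale crossed =
  fixes S :: "('a, 'g) tsystem" and P :: "('a, 'g, 'b) crossed_product"
  assumes crossed: "reduced_crossed_product S P"
begin

lemma twisted: "twisted_system S"
  using crossed by (simp add: reduced_crossed_product_def)

abbreviation A where "A \<equiv> alg S"
abbreviation C where "C \<equiv> cp P"
abbreviation G where "G \<equiv> grp S"
abbreviation \<iota> where "\<iota> \<equiv> emb P"
abbreviation L where "L \<equiv> uni P"
abbreviation E where "E \<equiv> expt P"
abbreviation \<alpha> where "\<alpha> \<equiv> act S"
abbreviation \<sigma> where "\<sigma> \<equiv> cocycle S"

sublocale A: cstar_alg A
  using twisted by (intro cstar_algI) (simp add: twisted_system_def)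

sublocale C: cstar_alg C
  using crossed by (intro cstar_algI) (simp add: reduced_crossed_product_def)

sublocale G: group G
  using twisted by (simp add: twisted_system_def)

lemmas emb_hom = reduced_crossed_product.emb_hom[OF crossed]
lemmas emb = star_homD[OF emb_hom]
lemmas cov = reduced_crossed_product.covariance[OF crossed]
  and uni_mult = reduced_crossed_product.uni_mult[OF crossed]
  and E_uni = reduced_crossed_product.expt_uni[OF crossed]
  and uni_unitary = reduced_crossed_product.uni_unitary[OF crossed]

lemma act_hom: "g \<in> carrier G \<Longrightarrow> \<alpha> g \<in> star_hom A A"
  using twisted_system.act_aut[OF twisted] by (simp add: star_iso_def)

lemmas act = star_homD[OF act_hom]

lemma act_zero: "g \<in> carrier G \<Longrightarrow> \<alpha> g \<zero>\<^bsub>A\<^esub> = \<zero>\<^bsub>A\<^esub>"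
  using star_hom_zero[OF act_hom] A.cstar_alg_axioms by blast

lemma uni: assumes "g \<in> carrier G"
  shows "L g \<in> carrier C" "star C (L g) \<otimes>\<^bsub>C\<^esub> L g = \<one>\<^bsub>C\<^esub>" "L g \<otimes>\<^bsub>C\<^esub> star C (L g) = \<one>\<^bsub>C\<^esub>"
  using uni_unitary[OF assms] by (auto simp: unitaries_def)

lemma cocycle: assumes "g \<in> carrier G" "h \<in> carrier G"
  shows "\<sigma> g h \<in> carrier A" "star A (\<sigma> g h) \<otimes>\<^bsub>A\<^esub> \<sigma> g h = \<one>\<^bsub>A\<^esub>" "\<sigma> g h \<otimes>\<^bsub>A\<^esub> star A (\<sigma> g h) = \<one>\<^bsub>A\<^esub>"
  using twisted_system.cocycle_unitary[OF twisted assms] by (auto simp: unitaries_def)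

lemma E:
  shows "x \<in> carrier C \<Longrightarrow> E x \<in> carrier A"
    and "\<lbrakk>x \<in> carrier C; y \<in> carrier C\<rbrakk> \<Longrightarrow> E (x \<oplus>\<^bsub>C\<^esub> y) = E x \<oplus>\<^bsub>A\<^esub> E y"
    and "x \<in> carrier C \<Longrightarrow> E (c \<odot>\<^bsub>C\<^esub> x) = c \<odot>\<^bsub>A\<^esub> E x"
    and "x \<in> carrier C \<Longrightarrow> nrm A (E x) \<le> nrm C x"
    and "x \<in> carrier C \<Longrightarrow> E (star C x \<otimes>\<^bsub>C\<^esub> x) \<in> positive_elements A"
    and "a \<in> carrier A \<Longrightarrow> E (\<iota> a) = a"
    and "\<lbrakk>a \<in> carrier A; x \<in> carrier C\<rbrakk> \<Longrightarrow> E (\<iota> a \<otimes>\<^bsub>C\<^esub> x) = a \<otimes>\<^bsub>A\<^esub> E x"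
    and "\<lbrakk>a \<in> carrier A; x \<in> carrier C\<rbrakk> \<Longrightarrow> E (x \<otimes>\<^bsub>C\<^esub> \<iota> a) = E x \<otimes>\<^bsub>A\<^esub> a"
proof -
  note ce = reduced_crossed_product.expt_expectation[OF crossed, unfolded conditional_expectation_def]
  show "E (star C x \<otimes>\<^bsub>C\<^esub> x) \<in> positive_elements A" if "x \<in> carrier C"
  proof -
    have "star C x \<otimes>\<^bsub>C\<^esub> x \<in> positive_elements C"
      using that unfolding positive_elements_def by blast
    then show ?thesis using ce by blast
  qed
qed (use reduced_crossed_product.expt_expectation[OF crossed] in
    \<open>auto simp: conditional_expectation_def\<close>)

lemma E_faithful:
  assumes "x \<in> carrier C" "E (star C x \<otimes>\<^bsub>C\<^esub> x) = \<zero>\<^bsub>A\<^esub>" shows "x = \<zero>\<^bsub>C\<^esub>"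
proof -
  have "star C x \<otimes>\<^bsub>C\<^esub> x = \<zero>\<^bsub>C\<^esub>"
    using reduced_crossed_product.expt_faithful[OF crossed] assms
    by (auto simp: faithful_on_positives_def positive_elements_def)
  then show ?thesis
    using C.cstar_identity[of x] C.norm_eq_zero[of x] assms(1) by simp
qed

lemma E_diff: "\<lbrakk>x \<in> carrier C; y \<in> carrier C\<rbrakk> \<Longrightarrow> E (x \<ominus>\<^bsub>C\<^esub> y) = E x \<ominus>\<^bsub>A\<^esub> E y"
  using E(3)[of y "-1"] E(1)[of y] by (simp add: A.minus_eq C.minus_eq E(2) A.smult_minus_left C.smult_minus_left)

lemma E_zero: "E \<zero>\<^bsub>C\<^esub> = \<zero>\<^bsub>A\<^esub>"
  using E_diff[of "\<zero>\<^bsub>C\<^esub>" "\<zero>\<^bsub>C\<^esub>"] E(1)[of "\<zero>\<^bsub>C\<^esub>"] by simp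

lemma E_one: "E \<one>\<^bsub>C\<^esub> = \<one>\<^bsub>A\<^esub>"
  using E(6)[of "\<one>\<^bsub>A\<^esub>"] emb(4) by simp

text \<open>The element \<open>x\<close> is a linear combination of \<open>(x + 1)\<^sup>2\<close> and \<open>(x - 1)\<^sup>2\<close>.\<close>

lemma E_self_adjoint:
  assumes x: "x \<in> carrier C" "star C x = x" shows "star A (E x) = E x"
proof -
  have pos: "star A (E (y \<otimes>\<^bsub>C\<^esub> y)) = E (y \<otimes>\<^bsub>C\<^esub> y)" if y: "y \<in> carrier C" "star C y = y" for y
    using E(5)[OF y(1)] by (auto simp: y positive_elements_def A.star_mult)
  let ?p = "x \<oplus>\<^bsub>C\<^esub> \<one>\<^bsub>C\<^esub>" and ?m = "x \<ominus>\<^bsub>C\<^esub> \<one>\<^bsub>C\<^esub>"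
  have "?p \<otimes>\<^bsub>C\<^esub> ?p \<ominus>\<^bsub>C\<^esub> ?m \<otimes>\<^bsub>C\<^esub> ?m = (x \<oplus>\<^bsub>C\<^esub> x) \<oplus>\<^bsub>C\<^esub> (x \<oplus>\<^bsub>C\<^esub> x)"
    using x(1) by (simp add: C.minus_eq C.l_distr C.r_distr C.l_minus C.r_minus C.minus_add C.a_ac C.r_neg1 C.r_neg2 C.r_neg)
  then have "x = (1/4) \<odot>\<^bsub>C\<^esub> (?p \<otimes>\<^bsub>C\<^esub> ?p \<ominus>\<^bsub>C\<^esub> ?m \<otimes>\<^bsub>C\<^esub> ?m)"
    using x(1) C.half_add_self[of x] C.smult_smult[of "(x \<oplus>\<^bsub>C\<^esub> x) \<oplus>\<^bsub>C\<^esub> (x \<oplus>\<^bsub>C\<^esub> x)" "1/2" "1/2"] by simp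
  then have "E x = (1/4) \<odot>\<^bsub>A\<^esub> (E (?p \<otimes>\<^bsub>C\<^esub> ?p) \<ominus>\<^bsub>A\<^esub> E (?m \<otimes>\<^bsub>C\<^esub> ?m))"
    using x(1) E(3) E_diff by (metis C.add.m_closed C.m_closed C.minus_closed C.one_closed)
  moreover have "star A (E (?p \<otimes>\<^bsub>C\<^esub> ?p)) = E (?p \<otimes>\<^bsub>C\<^esub> ?p)" "star A (E (?m \<otimes>\<^bsub>C\<^esub> ?m)) = E (?m \<otimes>\<^bsub>C\<^esub> ?m)"
    using x by (intro pos; simp add: C.star_add C.star_diff)+
  ultimately show ?thesis
    using x(1) E(1) by (simp add: A.star_smult A.star_diff)
qed

text \<open>Compatibility with adjoints is not part of \<open>conditional_expectation\<close>. It
  comes from \<open>E_self_adjoint\<close> for x + \<open>star x\<close> and \<i>(x -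
  \<open>star x\<close>), whose equations add up to twice the claim.\<close>

lemma E_star:
  assumes x: "x \<in> carrier C" shows "E (star C x) = star A (E x)"
proof -
  let ?a = "E x" and ?b = "E (star C x)"
  have ab: "?a \<in> carrier A" "?b \<in> carrier A" using x E(1) by auto
  have 1: "star A ?a \<oplus>\<^bsub>A\<^esub> star A ?b = ?a \<oplus>\<^bsub>A\<^esub> ?b"
    using E_self_adjoint[of "x \<oplus>\<^bsub>C\<^esub> star C x"] x ab
    by (simp add: C.star_add C.a_comm E(2) A.star_add)
  have "star C (\<i> \<odot>\<^bsub>C\<^esub> (x \<ominus>\<^bsub>C\<^esub> star C x)) = \<i> \<odot>\<^bsub>C\<^esub> (x \<ominus>\<^bsub>C\<^esub> star C x)"
    using x by (simp add: C.star_smult C.star_diff C.smult_minus_left C.smult_minus_right[symmetric] C.minus_diff)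
  then have "star A (\<i> \<odot>\<^bsub>A\<^esub> (?a \<ominus>\<^bsub>A\<^esub> ?b)) = \<i> \<odot>\<^bsub>A\<^esub> (?a \<ominus>\<^bsub>A\<^esub> ?b)"
    using E_self_adjoint[of "\<i> \<odot>\<^bsub>C\<^esub> (x \<ominus>\<^bsub>C\<^esub> star C x)"] x by (simp add: E(3) E_diff)
  then have "\<i> \<odot>\<^bsub>A\<^esub> (star A ?b \<ominus>\<^bsub>A\<^esub> star A ?a) = \<i> \<odot>\<^bsub>A\<^esub> (?a \<ominus>\<^bsub>A\<^esub> ?b)"
    using ab by (simp add: A.star_smult A.star_diff A.smult_minus_left A.smult_minus_right[symmetric] A.minus_diff)
  then have "(- \<i>) \<odot>\<^bsub>A\<^esub> (\<i> \<odot>\<^bsub>A\<^esub> (star A ?b \<ominus>\<^bsub>A\<^esub> star A ?a)) = (- \<i>) \<odot>\<^bsub>A\<^esub> (\<i> \<odot>\<^bsub>A\<^esub> (?a \<ominus>\<^bsub>A\<^esub> ?b))"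
    by simp
  then have 2: "star A ?b \<ominus>\<^bsub>A\<^esub> star A ?a = ?a \<ominus>\<^bsub>A\<^esub> ?b"
    using ab by (simp add: A.smult_smult)
  have "(star A ?b \<ominus>\<^bsub>A\<^esub> star A ?a) \<oplus>\<^bsub>A\<^esub> (star A ?a \<oplus>\<^bsub>A\<^esub> star A ?b) = star A ?b \<oplus>\<^bsub>A\<^esub> star A ?b"
    using ab by (simp add: A.minus_eq A.a_assoc A.r_neg1 A.r_neg2 A.r_neg)
  moreover have "(?a \<ominus>\<^bsub>A\<^esub> ?b) \<oplus>\<^bsub>A\<^esub> (?b \<oplus>\<^bsub>A\<^esub> ?a) = ?a \<oplus>\<^bsub>A\<^esub> ?a"
    using ab by (simp add: A.minus_eq A.a_assoc A.r_neg1 A.r_neg2 A.r_neg)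
  ultimately have "star A ?b \<oplus>\<^bsub>A\<^esub> star A ?b = ?a \<oplus>\<^bsub>A\<^esub> ?a"
    using 1 2 ab by (simp add: A.a_comm)
  then have "star A ?b = ?a"
    by (metis A.half_add_self A.star_closed ab)
  then show ?thesis by (metis A.star_star ab(2))
qed

section \<open>The unitaries \<open>L g\<close> and the dense span of their multiples by A\<close>

lemma uni_one: "L \<one>\<^bsub>G\<^esub> = \<one>\<^bsub>C\<^esub>"
proof -
  let ?u = "L \<one>\<^bsub>G\<^esub>"
  have u: "?u \<in> carrier C" "?u \<otimes>\<^bsub>C\<^esub> star C ?u = \<one>\<^bsub>C\<^esub>" using uni[of "\<one>\<^bsub>G\<^esub>"] by auto
  \<comment> \<open>The normalized cocycle makes \<open>?u\<close> idempotent, and an idempotent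
    unitary is 1.\<close>
  have "?u \<otimes>\<^bsub>C\<^esub> ?u = ?u"
    using uni_mult[of "\<one>\<^bsub>G\<^esub>" "\<one>\<^bsub>G\<^esub>"] twisted_system.cocycle_one[OF twisted, of "\<one>\<^bsub>G\<^esub>"] emb(4) u by simp
  then have "?u \<otimes>\<^bsub>C\<^esub> ?u \<otimes>\<^bsub>C\<^esub> star C ?u = \<one>\<^bsub>C\<^esub>" using u by simp
  then show ?thesis using u by (simp add: C.m_assoc)
qed

text \<open>By \<open>uni_mult\<close> and \<open>uni_one\<close>, L(g^-1) L(g) is the image of
  \<sigma>(g^-1, g); solving for the adjoint of \<open>L g\<close> shows that \<open>span\<close> is
  closed under adjoints.\<close>

lemma star_uni:
  assumes g: "g \<in> carrier G"
  shows "star C (L g) = \<iota> (star A (\<sigma> (inv\<^bsub>G\<^esub> g) g)) \<otimes>\<^bsub>C\<^esub> L (inv\<^bsub>G\<^esub> g)"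
proof -
  let ?s = "\<sigma> (inv\<^bsub>G\<^esub> g) g" and ?v = "L (inv\<^bsub>G\<^esub> g)"
  have s: "?s \<in> carrier A" "star A ?s \<otimes>\<^bsub>A\<^esub> ?s = \<one>\<^bsub>A\<^esub>" using cocycle[of "inv\<^bsub>G\<^esub> g" g] g by auto
  have v: "?v \<in> carrier C" using uni[of "inv\<^bsub>G\<^esub> g"] g by auto
  have "?v \<otimes>\<^bsub>C\<^esub> L g = \<iota> ?s"
    using uni_mult[of "inv\<^bsub>G\<^esub> g" g] g emb(1)[OF s(1)] by (simp add: G.l_inv uni_one)
  then have "?v \<otimes>\<^bsub>C\<^esub> L g \<otimes>\<^bsub>C\<^esub> star C (L g) = \<iota> ?s \<otimes>\<^bsub>C\<^esub> star C (L g)" by simp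
  then have "?v = \<iota> ?s \<otimes>\<^bsub>C\<^esub> star C (L g)"
    using v uni[OF g] by (simp add: C.m_assoc)
  then have "\<iota> (star A ?s) \<otimes>\<^bsub>C\<^esub> ?v = \<iota> (star A ?s \<otimes>\<^bsub>A\<^esub> ?s) \<otimes>\<^bsub>C\<^esub> star C (L g)"
    using s(1) emb(1) uni[OF g] by (simp add: emb(2) C.m_assoc)
  then show ?thesis using uni[OF g] emb(4) by (simp add: s)
qed

lemma uni_emb:
  assumes "g \<in> carrier G" "a \<in> carrier A"
  shows "L g \<otimes>\<^bsub>C\<^esub> \<iota> a = \<iota> (\<alpha> g a) \<otimes>\<^bsub>C\<^esub> L g"
  using assms uni[OF assms(1)] emb(1)[OF assms(2)] by (simp add: cov C.m_assoc)

text \<open>Scalars are absorbed into the coefficient from A, so closing under sums already gives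
  the linear span, with a two-case induction rule.\<close>

inductive_set span :: "'b set" where
  gen: "\<lbrakk>a \<in> carrier A; g \<in> carrier G\<rbrakk> \<Longrightarrow> \<iota> a \<otimes>\<^bsub>C\<^esub> L g \<in> span"
| add: "\<lbrakk>x \<in> span; y \<in> span\<rbrakk> \<Longrightarrow> x \<oplus>\<^bsub>C\<^esub> y \<in> span"

lemma span_closed: "x \<in> span \<Longrightarrow> x \<in> carrier C"
  by (induction rule: span.induct) (auto simp: emb uni)

text \<open>Covariance moves \<open>L g\<close> past the image of b, and the cocycle merges
  \<open>L g\<close> with \<open>L h\<close>.\<close>

lemma gen_mult_gen:
  assumes "a \<in> carrier A" "g \<in> carrier G" "b \<in> carrier A" "h \<in> carrier G"
  shows "(\<iota> a \<otimes>\<^bsub>C\<^esub> L g) \<otimes>\<^bsub>C\<^esub> (\<iota> b \<otimes>\<^bsub>C\<^esub> L h) =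
    \<iota> (a \<otimes>\<^bsub>A\<^esub> \<alpha> g b \<otimes>\<^bsub>A\<^esub> \<sigma> g h) \<otimes>\<^bsub>C\<^esub> L (g \<otimes>\<^bsub>G\<^esub> h)"
proof -
  have c: "\<iota> a \<in> carrier C" "L g \<in> carrier C" "\<iota> b \<in> carrier C" "L h \<in> carrier C" "\<alpha> g b \<in> carrier A"
    "\<iota> (\<alpha> g b) \<in> carrier C" "\<sigma> g h \<in> carrier A" "\<iota> (\<sigma> g h) \<in> carrier C" "L (g \<otimes>\<^bsub>G\<^esub> h) \<in> carrier C"
    using assms emb(1) uni(1) act(1) cocycle(1) by auto
  have "(\<iota> a \<otimes>\<^bsub>C\<^esub> L g) \<otimes>\<^bsub>C\<^esub> (\<iota> b \<otimes>\<^bsub>C\<^esub> L h) = \<iota> a \<otimes>\<^bsub>C\<^esub> (L g \<otimes>\<^bsub>C\<^esub> \<iota> b) \<otimes>\<^bsub>C\<^esub> L h"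
    using c by (simp add: C.m_assoc)
  also have "\<dots> = \<iota> a \<otimes>\<^bsub>C\<^esub> \<iota> (\<alpha> g b) \<otimes>\<^bsub>C\<^esub> (L g \<otimes>\<^bsub>C\<^esub> L h)"
    using c assms by (simp add: uni_emb C.m_assoc)
  also have "\<dots> = \<iota> (a \<otimes>\<^bsub>A\<^esub> \<alpha> g b \<otimes>\<^bsub>A\<^esub> \<sigma> g h) \<otimes>\<^bsub>C\<^esub> L (g \<otimes>\<^bsub>G\<^esub> h)"
    using c assms by (simp add: uni_mult emb(2) C.m_assoc)
  finally show ?thesis .
qed

lemma span_mult:
  assumes "x \<in> span" "y \<in> span" shows "x \<otimes>\<^bsub>C\<^esub> y \<in> span"
  using assms(1)
proof (induction rule: span.induct)
  case (gen a g)
  note ag = gen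
  show ?case
    using assms(2)
  proof (induction rule: span.induct)
    case (gen b h)
    then show ?case
      using ag act(1) cocycle(1) by (simp add: gen_mult_gen span.gen)
  next
    case (add y z)
    then show ?case
      using ag emb(1) uni(1) span_closed by (simp add: C.r_distr span.add)
  qed
next
  case (add x z)
  then show ?case using span_closed assms(2) by (simp add: C.l_distr span.add)
qed

lemma span_emb_uni:
  shows "a \<in> carrier A \<Longrightarrow> \<iota> a \<in> span" "g \<in> carrier G \<Longrightarrow> L g \<in> span"
  using span.gen[of a "\<one>\<^bsub>G\<^esub>"] span.gen[of "\<one>\<^bsub>A\<^esub>" g] emb(1)[of a] uni(1)[of g] emb(4)
  by (auto simp: uni_one)

lemma span_star:
  assumes "x \<in> span" shows "star C x \<in> span"
  using assms
proof (induction rule: span.induct)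
  case (gen a g)
  have "star C (\<iota> a \<otimes>\<^bsub>C\<^esub> L g) = star C (L g) \<otimes>\<^bsub>C\<^esub> \<iota> (star A a)"
    using gen emb(1) uni(1) by (simp add: C.star_mult emb(6))
  moreover have "star C (L g) \<in> span"
    using gen cocycle(1) by (simp add: star_uni span.gen)
  ultimately show ?case using gen span_mult span_emb_uni(1) by simp
next
  case (add x y)
  then show ?case using span_closed by (simp add: C.star_add span.add)
qed

lemma span_smult: assumes "x \<in> span" shows "c \<odot>\<^bsub>C\<^esub> x \<in> span"
proof -
  have "c \<odot>\<^bsub>C\<^esub> x = \<iota> (c \<odot>\<^bsub>A\<^esub> \<one>\<^bsub>A\<^esub>) \<otimes>\<^bsub>C\<^esub> x"
    using span_closed[OF assms] emb(4) by (simp add: emb(5) C.smult_mult_left)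
  then show ?thesis using span_mult[OF span_emb_uni(1) assms] by simp
qed

text \<open>The closure is a C*-subalgebra containing all generators, so \<open>generated\<close>
  applies.\<close>

lemma cl_span: "C.cl span = carrier C"
proof -
  have sub: "span \<subseteq> carrier C" using span_closed by blast
  have mult: "x \<otimes>\<^bsub>C\<^esub> y \<in> C.cl span" if "x \<in> C.cl span" "y \<in> C.cl span" for x y
    using that sub span_mult by (rule C.cl_mult)
  have in_cl: "x \<in> C.cl span" if "x \<in> span" for x using that C.cl_subset[OF sub] by blast
  have smult: "c \<odot>\<^bsub>C\<^esub> x \<in> C.cl span" if x: "x \<in> C.cl span" for c x
  proof -
    have xc: "x \<in> carrier C" using x C.cl_carrier by blast
    have "c \<odot>\<^bsub>C\<^esub> \<one>\<^bsub>C\<^esub> \<in> C.cl span"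
      using in_cl[OF span_smult[OF span_emb_uni(1)[of "\<one>\<^bsub>A\<^esub>"]]] emb(4) by simp
    then have "(c \<odot>\<^bsub>C\<^esub> \<one>\<^bsub>C\<^esub>) \<otimes>\<^bsub>C\<^esub> x \<in> C.cl span" using x by (rule mult)
    then show ?thesis using xc by (simp add: C.smult_mult_left)
  qed
  have "cstar_subalgebra (C.cl span) C"
    unfolding cstar_subalgebra_def
  proof (intro conjI ballI allI C.closedin_cl smult)
    show "subring (C.cl span) C"
    proof (rule C.subringI)
      show "\<one>\<^bsub>C\<^esub> \<in> C.cl span" using in_cl[OF span_emb_uni(1)[of "\<one>\<^bsub>A\<^esub>"]] emb(4) by simp
      show "\<ominus>\<^bsub>C\<^esub> x \<in> C.cl span" if "x \<in> C.cl span" for x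
        using smult[OF that, of "-1"] that C.cl_carrier[of span] by (auto simp: C.smult_minus_left subset_iff)
      show "x \<oplus>\<^bsub>C\<^esub> y \<in> C.cl span" if "x \<in> C.cl span" "y \<in> C.cl span" for x y
        using that sub span.add by (rule C.cl_add)
    qed (fact C.cl_carrier mult)+
    fix x assume x: "x \<in> C.cl span"
    then have xc: "x \<in> carrier C" using C.cl_carrier by blast
    show "star C x \<in> C.cl span"
      using xc span_star span_closed
      by (intro C.cl_map[OF x sub _ sub, of _ 1]) (auto simp: C.star_diff[symmetric])
  qed
  moreover have "\<iota> ` carrier A \<union> L ` carrier G \<subseteq> C.cl span"
    using in_cl span_emb_uni by blast
  ultimately have "cstar_generated C (\<iota> ` carrier A \<union> L ` carrier G) \<subseteq> C.cl span"
    unfolding cstar_generated_def by blast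
  then show ?thesis
    using reduced_crossed_product.generated[OF crossed] C.cl_carrier by blast
qed

text \<open>Additivity carries equality from the generators to \<open>span\<close>, contractivity
  carries it to the closure. The maps are not taken multiplicative because the lemma serves for
  expectations.\<close>

lemma eq_if_eq_on_generators:
  assumes "cstar_alg D" and F: "\<And>x. x \<in> carrier C \<Longrightarrow> F x \<in> carrier D \<and> nrm D (F x) \<le> nrm C x"
      "\<And>x y. \<lbrakk>x \<in> carrier C; y \<in> carrier C\<rbrakk> \<Longrightarrow> F (x \<oplus>\<^bsub>C\<^esub> y) = F x \<oplus>\<^bsub>D\<^esub> F y"
    and H: "\<And>x. x \<in> carrier C \<Longrightarrow> H x \<in> carrier D \<and> nrm D (H x) \<le> nrm C x"
      "\<And>x y. \<lbrakk>x \<in> carrier C; y \<in> carrier C\<rbrakk> \<Longrightarrow> H (x \<oplus>\<^bsub>C\<^esub> y) = H x \<oplus>\<^bsub>D\<^esub> H y"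
    and eq: "\<And>a g. \<lbrakk>a \<in> carrier A; g \<in> carrier G\<rbrakk> \<Longrightarrow> F (\<iota> a \<otimes>\<^bsub>C\<^esub> L g) = H (\<iota> a \<otimes>\<^bsub>C\<^esub> L g)"
    and x: "x \<in> carrier C"
  shows "F x = H x"
proof -
  interpret D: cstar_alg D by fact
  have eq': "F y = H y" if "y \<in> span" for y
    using that by (induction rule: span.induct) (auto simp: eq F(2) H(2) span_closed)
  show ?thesis
  proof (rule D.eq_if_norm_diff_small)
    fix e :: real assume "e > 0"
    moreover have "x \<in> C.cl span" "span \<subseteq> carrier C" using x cl_span span_closed by auto
    ultimately obtain d where d: "d \<in> span" "nrm C (x \<ominus>\<^bsub>C\<^esub> d) < e / 2"
      using C.cl_approx[of x span "e / 2"] by auto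
    let ?r = "x \<ominus>\<^bsub>C\<^esub> d"
    have dc: "d \<in> carrier C" "?r \<in> carrier C" using d x span_closed by auto
    have "x = ?r \<oplus>\<^bsub>C\<^esub> d" using x dc by simp
    then have "F x = F ?r \<oplus>\<^bsub>D\<^esub> F d" "H x = H ?r \<oplus>\<^bsub>D\<^esub> F d"
      using F(2)[OF dc(2,1)] H(2)[OF dc(2,1)] eq'[OF d(1)] by simp_all
    then have "F x \<ominus>\<^bsub>D\<^esub> H x = F ?r \<ominus>\<^bsub>D\<^esub> H ?r"
      using F(1) H(1) dc by (simp add: D.add_diff_add)
    then show "nrm D (F x \<ominus>\<^bsub>D\<^esub> H x) \<le> e"
      using D.norm_diff_le[of "F ?r" "H ?r"] F(1)[OF dc(2)] H(1)[OF dc(2)] d(2) by simp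
  qed (use F H x in auto)
qed

lemma E_gen:
  assumes "a \<in> carrier A" "g \<in> carrier G"
  shows "E (\<iota> a \<otimes>\<^bsub>C\<^esub> L g) = (if g = \<one>\<^bsub>G\<^esub> then a else \<zero>\<^bsub>A\<^esub>)"
  using assms uni(1) E(7)[of a "L g"] E_uni[of g] E_one by (auto simp: uni_one)

text \<open>This equivariance makes E(K) stable under the action. Both sides are additive
  contractions in x, so generators suffice.\<close>

lemma E_conj_uni:
  assumes g: "g \<in> carrier G" and x: "x \<in> carrier C"
  shows "\<alpha> g (E x) = E (L g \<otimes>\<^bsub>C\<^esub> x \<otimes>\<^bsub>C\<^esub> star C (L g))"
proof (rule eq_if_eq_on_generators[OF A.cstar_alg_axioms _ _ _ _ _ x])
  fix x assume x: "x \<in> carrier C"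
  show "\<alpha> g (E x) \<in> carrier A \<and> nrm A (\<alpha> g (E x)) \<le> nrm C x"
    using star_hom_contractive[OF act_hom[OF g] A.cstar_alg_axioms A.cstar_alg_axioms E(1)[OF x]]
      act(1)[OF g E(1)[OF x]] E(4)[OF x] by simp
  have "nrm C (L g \<otimes>\<^bsub>C\<^esub> x \<otimes>\<^bsub>C\<^esub> star C (L g)) \<le> nrm C x"
  proof -
    have u: "nrm C (L g) \<le> 1" using C.norm_unitary_le[OF uni_unitary[OF g]] .
    have "nrm C (L g \<otimes>\<^bsub>C\<^esub> x \<otimes>\<^bsub>C\<^esub> star C (L g)) \<le> nrm C (L g \<otimes>\<^bsub>C\<^esub> x) * nrm C (L g)"
      using C.norm_mult[of "L g \<otimes>\<^bsub>C\<^esub> x" "star C (L g)"] uni(1)[OF g] x by simp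
    also have "\<dots> \<le> nrm C (L g \<otimes>\<^bsub>C\<^esub> x)"
      using u uni(1)[OF g] x by (intro mult_left_le) auto
    also have "\<dots> \<le> nrm C (L g) * nrm C x"
      using uni(1)[OF g] x by (intro C.norm_mult) auto
    also have "\<dots> \<le> nrm C x"
      using u uni(1)[OF g] x by (intro mult_left_le_one_le) auto
    finally show ?thesis .
  qed
  then show "E (L g \<otimes>\<^bsub>C\<^esub> x \<otimes>\<^bsub>C\<^esub> star C (L g)) \<in> carrier A \<and>
      nrm A (E (L g \<otimes>\<^bsub>C\<^esub> x \<otimes>\<^bsub>C\<^esub> star C (L g))) \<le> nrm C x"
    using E(1,4)[of "L g \<otimes>\<^bsub>C\<^esub> x \<otimes>\<^bsub>C\<^esub> star C (L g)"] uni(1)[OF g] x by auto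
next
  fix x y assume "x \<in> carrier C" "y \<in> carrier C"
  then show "\<alpha> g (E (x \<oplus>\<^bsub>C\<^esub> y)) = \<alpha> g (E x) \<oplus>\<^bsub>A\<^esub> \<alpha> g (E y)"
    and "E (L g \<otimes>\<^bsub>C\<^esub> (x \<oplus>\<^bsub>C\<^esub> y) \<otimes>\<^bsub>C\<^esub> star C (L g)) =
      E (L g \<otimes>\<^bsub>C\<^esub> x \<otimes>\<^bsub>C\<^esub> star C (L g)) \<oplus>\<^bsub>A\<^esub> E (L g \<otimes>\<^bsub>C\<^esub> y \<otimes>\<^bsub>C\<^esub> star C (L g))"
    using g uni(1)[OF g] by (simp_all add: E(1,2) act(3) C.l_distr C.r_distr)
next
  fix a h assume a: "a \<in> carrier A" and h: "h \<in> carrier G"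
  let ?s = "\<sigma> (inv\<^bsub>G\<^esub> g) g"
  have c: "L g \<in> carrier C" "L h \<in> carrier C" "\<iota> a \<in> carrier C" "\<alpha> g a \<in> carrier A" "?s \<in> carrier A"
    using a g h emb(1) uni(1) act(1) cocycle(1) by auto
  show "\<alpha> g (E (\<iota> a \<otimes>\<^bsub>C\<^esub> L h)) = E (L g \<otimes>\<^bsub>C\<^esub> (\<iota> a \<otimes>\<^bsub>C\<^esub> L h) \<otimes>\<^bsub>C\<^esub> star C (L g))"
  proof (cases "h = \<one>\<^bsub>G\<^esub>")
    case True
    then show ?thesis
      using a g c E(6)[OF c(4)] cov[OF g a] by (simp add: E_gen uni_one E(6))
  next
    \<comment> \<open>The conjugate of h by g is again different from the identity, so both sides
      vanish. The coefficients t and r arise from applying \<open>gen_mult_gen\<close>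
      twice.\<close>
    case False
    define t where "t = \<one>\<^bsub>A\<^esub> \<otimes>\<^bsub>A\<^esub> \<alpha> g a \<otimes>\<^bsub>A\<^esub> \<sigma> g h"
    define r where "r = t \<otimes>\<^bsub>A\<^esub> \<alpha> (g \<otimes>\<^bsub>G\<^esub> h) (star A ?s) \<otimes>\<^bsub>A\<^esub> \<sigma> (g \<otimes>\<^bsub>G\<^esub> h) (inv\<^bsub>G\<^esub> g)"
    have tr: "t \<in> carrier A" "r \<in> carrier A"
      using c g h cocycle(1) act(1) by (auto simp: t_def r_def)
    have "L g = \<iota> \<one>\<^bsub>A\<^esub> \<otimes>\<^bsub>C\<^esub> L g" using c emb(4) by simp
    then have "L g \<otimes>\<^bsub>C\<^esub> (\<iota> a \<otimes>\<^bsub>C\<^esub> L h) = \<iota> t \<otimes>\<^bsub>C\<^esub> L (g \<otimes>\<^bsub>G\<^esub> h)"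
      using gen_mult_gen[of "\<one>\<^bsub>A\<^esub>" g a h] a g h by (simp add: t_def)
    then have "L g \<otimes>\<^bsub>C\<^esub> (\<iota> a \<otimes>\<^bsub>C\<^esub> L h) \<otimes>\<^bsub>C\<^esub> star C (L g) =
        \<iota> r \<otimes>\<^bsub>C\<^esub> L (g \<otimes>\<^bsub>G\<^esub> h \<otimes>\<^bsub>G\<^esub> inv\<^bsub>G\<^esub> g)"
      using gen_mult_gen[of t "g \<otimes>\<^bsub>G\<^esub> h" "star A ?s" "inv\<^bsub>G\<^esub> g"] tr c g h by (simp add: star_uni r_def)
    moreover have "g \<otimes>\<^bsub>G\<^esub> h \<otimes>\<^bsub>G\<^esub> inv\<^bsub>G\<^esub> g \<noteq> \<one>\<^bsub>G\<^esub>"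
      using False g h by (metis G.inv_closed G.inv_equality G.inv_inv G.l_cancel_one' G.m_closed)
    ultimately show ?thesis
      using False a g h tr by (simp add: E_gen act_zero)
  qed
qed

end

section \<open>The invariant ideal generated by expectations\<close>

context crossed
begin

text \<open>The normalized cocycle makes the automorphism at the identity idempotent, and it is
  injective.\<close>

lemma act_one: assumes a: "a \<in> carrier A" shows "\<alpha> \<one>\<^bsub>G\<^esub> a = a"
proof -
  have "\<alpha> \<one>\<^bsub>G\<^esub> (\<alpha> \<one>\<^bsub>G\<^esub> a) = \<alpha> \<one>\<^bsub>G\<^esub> a"
    using twisted_system.act_act[OF twisted, of "\<one>\<^bsub>G\<^esub>" "\<one>\<^bsub>G\<^esub>" a] act(1)[OF _ a]
      twisted_system.cocycle_one[OF twisted, of "\<one>\<^bsub>G\<^esub>"] a by simp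
  moreover have "inj_on (\<alpha> \<one>\<^bsub>G\<^esub>) (carrier A)"
    using twisted_system.act_aut[OF twisted, of "\<one>\<^bsub>G\<^esub>"] by (simp add: star_iso_def bij_betw_def)
  ultimately show ?thesis using act(1)[OF G.one_closed a] a by (meson inj_onD)
qed

definition expectation_ideal :: "'b set \<Rightarrow> 'a set"
  where "expectation_ideal K = A.cl (E ` K)"

context
  fixes K assumes K: "closed_ideal K C"
begin

lemma image_expt_carrier: "E ` K \<subseteq> carrier A"
  using closed_idealD(2)[OF K] E(1) by blast

text \<open>\<open>E\<close> is an A-bimodule map, so E(K) is already an algebraic ideal of A before
  taking the closure.\<close>

lemma closed_expectation_ideal: "closed_ideal (expectation_ideal K) A"
  unfolding expectation_ideal_def
proof (rule A.closed_ideal_cl[OF image_expt_carrier])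
  note I = closed_idealD[OF K]
  show "\<zero>\<^bsub>A\<^esub> \<in> E ` K" using E_zero I(3) by (metis imageI)
  show "s \<oplus>\<^bsub>A\<^esub> t \<in> E ` K" if "s \<in> E ` K" "t \<in> E ` K" for s t
    using that I(2,4) E(2) by (smt (verit) imageE imageI)
  fix s a assume "s \<in> E ` K" and a: "a \<in> carrier A"
  then obtain x where x: "x \<in> K" "s = E x" by blast
  then show "s \<otimes>\<^bsub>A\<^esub> a \<in> E ` K" "a \<otimes>\<^bsub>A\<^esub> s \<in> E ` K"
    using I(2)[OF x(1)] I(6,7)[OF x(1) emb(1)[OF a]] E(7,8)[OF a] by (metis imageI)+
qed

lemma act_expectation_ideal:
  assumes g: "g \<in> carrier G" and a: "a \<in> expectation_ideal K" shows "\<alpha> g a \<in> expectation_ideal K"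
proof -
  note I = closed_idealD[OF K]
  have ac: "a \<in> carrier A" using closed_idealD(2)[OF closed_expectation_ideal a] .
  show ?thesis
    unfolding expectation_ideal_def
  proof (rule A.cl_map[OF a[unfolded expectation_ideal_def] image_expt_carrier _ image_expt_carrier])
    show "\<alpha> g ` E ` K \<subseteq> E ` K"
    proof safe
      fix x assume x: "x \<in> K"
      have "L g \<otimes>\<^bsub>C\<^esub> x \<otimes>\<^bsub>C\<^esub> star C (L g) \<in> K"
        using I(6,7) x uni(1)[OF g] by simp
      then show "\<alpha> g (E x) \<in> E ` K" using E_conj_uni[OF g I(2)[OF x]] by simp
    qed
    show "nrm A (\<alpha> g a \<ominus>\<^bsub>A\<^esub> \<alpha> g t) \<le> 1 * nrm A (a \<ominus>\<^bsub>A\<^esub> t)" if "t \<in> E ` K" for t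
    proof -
      have t: "t \<in> carrier A" using that image_expt_carrier by blast
      note aut = act_hom[OF g] A.cstar_alg_axioms A.cstar_alg_axioms
      show ?thesis
        using star_hom_contractive[OF aut A.minus_closed[OF ac t]] star_hom_diff[OF aut ac t] by simp
    qed
  qed (use act(1)[OF g ac] in auto)
qed

lemma invariant_expectation_ideal: "invariant_ideal S (expectation_ideal K)"
  unfolding invariant_ideal_def
proof (intro conjI ballI closed_expectation_ideal equalityI subsetI)
  fix g assume g: "g \<in> carrier G"
  show "a \<in> expectation_ideal K" if "a \<in> \<alpha> g ` expectation_ideal K" for a
    using that act_expectation_ideal[OF g] by blast
  fix a assume a: "a \<in> expectation_ideal K"
  note J = closed_idealD[OF closed_expectation_ideal]
  let ?h = "inv\<^bsub>G\<^esub> g"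
  let ?s = "\<sigma> g ?h"
  have h: "?h \<in> carrier G" using g by simp
  have ac: "a \<in> carrier A" using J(2)[OF a] .
  note s = cocycle[OF g h]
  \<comment> \<open>The automorphism at g^-1 inverts that at g only up to conjugation by \<sigma>(g,
    g^-1); b is a with this conjugation undone in advance.\<close>
  define b where "b = star A ?s \<otimes>\<^bsub>A\<^esub> a \<otimes>\<^bsub>A\<^esub> ?s"
  have b: "b \<in> expectation_ideal K" "b \<in> carrier A"
    using J(6,7) a s ac by (simp_all add: b_def)
  have "\<alpha> g (\<alpha> ?h b) = ?s \<otimes>\<^bsub>A\<^esub> b \<otimes>\<^bsub>A\<^esub> star A ?s"
    using twisted_system.act_act[OF twisted g h b(2)] g by (simp add: act_one b G.r_inv)
  also have "\<dots> = (?s \<otimes>\<^bsub>A\<^esub> star A ?s) \<otimes>\<^bsub>A\<^esub> a \<otimes>\<^bsub>A\<^esub> (?s \<otimes>\<^bsub>A\<^esub> star A ?s)"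
    using s(1) ac unfolding b_def by (simp add: A.m_assoc)
  also have "\<dots> = a" using s ac by simp
  finally have "a = \<alpha> g (\<alpha> ?h b)" by simp
  then show "a \<in> \<alpha> g ` expectation_ideal K"
    using act_expectation_ideal[OF h b(1)] by blast
qed

text \<open>
  If \<open>1\<close> is close to \<open>E(x)\<close> with \<open>x = x\<^sup>* \<in> K\<close>, then averaging \<open>x - E(x)\<close> over unitary conjugates
  gives an element of \<open>K\<close> close to \<open>1\<close>.
\<close>

lemma expectation_ideal_proper:
  assumes DP: "property_DP S P" and proper: "K \<noteq> carrier C"
  shows "expectation_ideal K \<noteq> carrier A"
proof
  note I = closed_idealD[OF K]
  assume "expectation_ideal K = carrier A"
  then have "\<one>\<^bsub>A\<^esub> \<in> A.cl (E ` K)" by (simp add: expectation_ideal_def)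
  then obtain x where x: "x \<in> K" "nrm A (\<one>\<^bsub>A\<^esub> \<ominus>\<^bsub>A\<^esub> E x) < 1/2"
    using A.cl_approx[OF _ image_expt_carrier, of "\<one>\<^bsub>A\<^esub>" "1/2"] by auto
  have xc: "x \<in> carrier C" "E x \<in> carrier A" using I(2)[OF x(1)] E(1) by auto
  \<comment> \<open>The real part of x stays in K, and its expectation is the real part of E(x),
    which is at least as close to 1.\<close>
  define w where "w = (1/2) \<odot>\<^bsub>C\<^esub> (x \<oplus>\<^bsub>C\<^esub> star C x)"
  have w: "w \<in> K" "w \<in> carrier C" "star C w = w"
    using C.closed_ideal_smult[OF K I(4)[OF x(1) C.closed_ideal_star[OF K x(1)]]] xc
    by (auto simp: w_def C.star_smult C.star_add C.a_comm)
  define e where "e = E w"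
  have e: "e \<in> carrier A" "star A e = e"
    using w E(1) E_self_adjoint by (auto simp: e_def)
  have "nrm A (\<one>\<^bsub>A\<^esub> \<ominus>\<^bsub>A\<^esub> e) < 1/2"
  proof -
    have "e = (1/2) \<odot>\<^bsub>A\<^esub> (E x \<oplus>\<^bsub>A\<^esub> star A (E x))"
      using xc by (simp add: e_def w_def E(2,3) E_star)
    moreover have "\<one>\<^bsub>A\<^esub> = (1/2) \<odot>\<^bsub>A\<^esub> (\<one>\<^bsub>A\<^esub> \<oplus>\<^bsub>A\<^esub> \<one>\<^bsub>A\<^esub>)" by simp
    ultimately have "\<one>\<^bsub>A\<^esub> \<ominus>\<^bsub>A\<^esub> e =
        (1/2) \<odot>\<^bsub>A\<^esub> ((\<one>\<^bsub>A\<^esub> \<ominus>\<^bsub>A\<^esub> E x) \<oplus>\<^bsub>A\<^esub> (\<one>\<^bsub>A\<^esub> \<ominus>\<^bsub>A\<^esub> star A (E x)))"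
      using xc by (metis A.add_diff_add A.smult_diff_right A.a_closed A.one_closed A.star_closed)
    moreover have "nrm A (\<one>\<^bsub>A\<^esub> \<ominus>\<^bsub>A\<^esub> star A (E x)) = nrm A (\<one>\<^bsub>A\<^esub> \<ominus>\<^bsub>A\<^esub> E x)"
      using A.norm_star[of "\<one>\<^bsub>A\<^esub> \<ominus>\<^bsub>A\<^esub> E x"] xc by (simp add: A.star_diff)
    ultimately show ?thesis
      using A.norm_half_le[of "\<one>\<^bsub>A\<^esub> \<ominus>\<^bsub>A\<^esub> E x" "\<one>\<^bsub>A\<^esub> \<ominus>\<^bsub>A\<^esub> star A (E x)"] xc x(2) by simp
  qed
  moreover define r where "r = nrm C (\<one>\<^bsub>C\<^esub> \<ominus>\<^bsub>C\<^esub> \<iota> e)"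
  ultimately have r: "r < 1/2"
    using star_hom_contractive[OF emb_hom A.cstar_alg_axioms C.cstar_alg_axioms, of "\<one>\<^bsub>A\<^esub> \<ominus>\<^bsub>A\<^esub> e"]
      star_hom_diff[OF emb_hom A.cstar_alg_axioms C.cstar_alg_axioms, of "\<one>\<^bsub>A\<^esub>" e] e emb(4)
    by simp
  define y where "y = w \<ominus>\<^bsub>C\<^esub> \<iota> e"
  have y: "y \<in> carrier C" "star C y = y" "E y = \<zero>\<^bsub>A\<^esub>"
  proof -
    have ec: "\<iota> e \<in> carrier C" "star C (\<iota> e) = \<iota> e" using e emb(1) emb(6)[of e] by auto
    show "y \<in> carrier C" "star C y = y" using ec w by (auto simp: y_def C.star_diff)
    show "E y = \<zero>\<^bsub>A\<^esub>" using ec w e E(6)[of e] by (simp add: y_def E_diff e_def[symmetric])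
  qed
  \<comment> \<open>Conjugation by v fixes 1, so it keeps the image of e within r of 1, while the
    conjugate of w stays in K.\<close>
  have orbit: "\<exists>k\<in>K. \<exists>b\<in>carrier C. z = k \<ominus>\<^bsub>C\<^esub> b \<and> nrm C (\<one>\<^bsub>C\<^esub> \<ominus>\<^bsub>C\<^esub> b) \<le> r"
    if z: "z \<in> unitary_orbit C y" for z
  proof -
    obtain v where v: "v \<in> unitaries C" "z = v \<otimes>\<^bsub>C\<^esub> y \<otimes>\<^bsub>C\<^esub> star C v"
      using z by (auto simp: unitary_orbit_def)
    then have vc: "v \<in> carrier C" "v \<otimes>\<^bsub>C\<^esub> star C v = \<one>\<^bsub>C\<^esub>" "nrm C v \<le> 1"
      using C.norm_unitary_le by (auto simp: unitaries_def)
    have ec: "\<iota> e \<in> carrier C" using e emb(1) by auto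
    let ?k = "v \<otimes>\<^bsub>C\<^esub> w \<otimes>\<^bsub>C\<^esub> star C v" and ?b = "v \<otimes>\<^bsub>C\<^esub> \<iota> e \<otimes>\<^bsub>C\<^esub> star C v"
    have "z = ?k \<ominus>\<^bsub>C\<^esub> ?b"
      using v vc w ec by (simp add: y_def C.mult_diff_left C.mult_diff_right)
    moreover have "?k \<in> K" using I(6,7) w vc by simp
    moreover have "nrm C (\<one>\<^bsub>C\<^esub> \<ominus>\<^bsub>C\<^esub> ?b) \<le> r"
    proof -
      let ?d = "\<one>\<^bsub>C\<^esub> \<ominus>\<^bsub>C\<^esub> \<iota> e"
      have "\<one>\<^bsub>C\<^esub> \<ominus>\<^bsub>C\<^esub> ?b = v \<otimes>\<^bsub>C\<^esub> ?d \<otimes>\<^bsub>C\<^esub> star C v"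
        using vc ec by (simp add: C.mult_diff_left C.mult_diff_right)
      also have "nrm C \<dots> \<le> nrm C v * nrm C ?d * nrm C v"
        using C.norm_mult[of "v \<otimes>\<^bsub>C\<^esub> ?d" "star C v"] C.norm_mult[of v ?d] vc ec
          mult_right_mono[of "nrm C (v \<otimes>\<^bsub>C\<^esub> ?d)" "nrm C v * nrm C ?d" "nrm C v"] by simp
      also have "\<dots> \<le> nrm C v * nrm C ?d"
        using vc ec by (intro mult_left_le) auto
      also have "\<dots> \<le> r"
        using vc ec unfolding r_def by (intro mult_left_le_one_le) auto
      finally show ?thesis .
    qed
    ultimately show ?thesis using vc ec by blast
  qed
  let ?H = "cstar_convex_hull C (unitary_orbit C y)"
  have hull: "\<exists>k\<in>K. \<exists>b\<in>carrier C. z = k \<ominus>\<^bsub>C\<^esub> b \<and> nrm C (\<one>\<^bsub>C\<^esub> \<ominus>\<^bsub>C\<^esub> b) \<le> r" if "z \<in> ?H" for z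
    using K orbit that by (rule C.convex_hull_near_one)
  have "?H \<subseteq> carrier C" using hull I(2) by fastforce
  moreover have "\<zero>\<^bsub>C\<^esub> \<in> C.cl ?H" using DP y by (simp add: property_DP_def)
  ultimately obtain z where z: "z \<in> ?H" "nrm C (\<zero>\<^bsub>C\<^esub> \<ominus>\<^bsub>C\<^esub> z) < 1/2"
    using C.cl_approx[of "\<zero>\<^bsub>C\<^esub>" ?H "1/2"] by auto
  obtain k b where k: "k \<in> K" "b \<in> carrier C" "z = k \<ominus>\<^bsub>C\<^esub> b" "nrm C (\<one>\<^bsub>C\<^esub> \<ominus>\<^bsub>C\<^esub> b) \<le> r"
    using hull[OF z(1)] by blast
  have kc: "k \<in> carrier C" using k(1) I(2) by simp
  \<comment> \<open>Here z = k - b is within 1/2 of 0 and b is within r < 1/2 of 1, so k lies at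
    distance less than 1 from 1.\<close>
  have "nrm C (b \<ominus>\<^bsub>C\<^esub> k) < 1/2"
    using z(2) k kc C.norm_diff_commute[of "\<zero>\<^bsub>C\<^esub>" z] C.norm_diff_commute[of k b] by simp
  then have "nrm C (\<one>\<^bsub>C\<^esub> \<ominus>\<^bsub>C\<^esub> k) < 1"
    using C.norm_diff_triangle[of "\<one>\<^bsub>C\<^esub>" b k] k kc r by simp
  then show False
    using C.closed_ideal_eq_carrier_if_near_one[OF K k(1)] proper by simp
qed

end

section \<open>The canonical homomorphism onto the crossed product of the quotient system\<close>

lemma canonical_homD:
  assumes "canonical_hom S J P R \<pi>"
  shows "\<pi> \<in> star_hom C (cp R)" "\<pi> ` carrier C = carrier (cp R)"
    and "a \<in> carrier A \<Longrightarrow> \<pi> (\<iota> a) = emb R (J +>\<^bsub>A\<^esub> a)"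
    and "g \<in> carrier G \<Longrightarrow> \<pi> (L g) = uni R g"
  using assms by (auto simp: canonical_hom_def)

context
  fixes J and R :: "('a set, 'g, 'c) crossed_product" and \<pi>
  assumes J: "invariant_ideal S J"
    and R: "reduced_crossed_product (system_quot S J) R"
    and \<pi>: "canonical_hom S J P R \<pi>"
begin

interpretation q: cstar_quotient A J
  using J by unfold_locales (simp add: invariant_ideal_def)

interpretation R: crossed "system_quot S J" R
  by (rule crossed.intro) (rule R)

lemma system_quot_simps: "alg (system_quot S J) = cstar_quot A J" "grp (system_quot S J) = G"
  by (simp_all add: system_quot_def)

lemmas pi = canonical_homD[OF \<pi>]
lemmas pi_hom = star_homD[OF pi(1)]

text \<open>Both sides are additive contractions into A/J. On the product of the image of a with
  \<open>L g\<close> both give the coset of a if g is the identity, and zero otherwise.\<close>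

lemma expt_canonical_hom:
  assumes x: "x \<in> carrier C" shows "expt R (\<pi> x) = J +>\<^bsub>A\<^esub> E x"
proof (rule eq_if_eq_on_generators[of "cstar_quot A J" _ "\<lambda>x. J +>\<^bsub>A\<^esub> E x", OF _ _ _ _ _ _ x])
  \<comment> \<open>This is read off from the base algebra of R.\<close>
  show "cstar_alg (cstar_quot A J)"
    using R.A.cstar_alg_axioms by (simp add: system_quot_simps)
  note RE = R.E[unfolded system_quot_simps]
  fix x assume x: "x \<in> carrier C"
  show "expt R (\<pi> x) \<in> carrier (cstar_quot A J) \<and> nrm (cstar_quot A J) (expt R (\<pi> x)) \<le> nrm C x"
    using star_hom_contractive[OF pi(1) C.cstar_alg_axioms R.C.cstar_alg_axioms x]
      RE(1,4)[OF pi_hom(1)[OF x]] by simp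
  show "J +>\<^bsub>A\<^esub> E x \<in> carrier (cstar_quot A J) \<and> nrm (cstar_quot A J) (J +>\<^bsub>A\<^esub> E x) \<le> nrm C x"
    using q.nrm_q_le_nrm[OF E(1)[OF x]] E(4)[OF x] q.q_closed[OF E(1)[OF x]] by simp
  fix y assume y: "y \<in> carrier C"
  show "expt R (\<pi> (x \<oplus>\<^bsub>C\<^esub> y)) = expt R (\<pi> x) \<oplus>\<^bsub>cstar_quot A J\<^esub> expt R (\<pi> y)"
    using x y RE(2) pi_hom(1,3) by simp
  show "J +>\<^bsub>A\<^esub> E (x \<oplus>\<^bsub>C\<^esub> y) = (J +>\<^bsub>A\<^esub> E x) \<oplus>\<^bsub>cstar_quot A J\<^esub> (J +>\<^bsub>A\<^esub> E y)"
    using x y E(1,2) by (simp add: q.q_add)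
next
  fix a g assume a: "a \<in> carrier A" and g: "g \<in> carrier G"
  have "\<pi> (\<iota> a \<otimes>\<^bsub>C\<^esub> L g) = emb R (J +>\<^bsub>A\<^esub> a) \<otimes>\<^bsub>cp R\<^esub> uni R g"
    using pi_hom(2)[OF emb(1)[OF a] uni(1)[OF g]] pi(3,4) a g by simp
  then show "expt R (\<pi> (\<iota> a \<otimes>\<^bsub>C\<^esub> L g)) = J +>\<^bsub>A\<^esub> E (\<iota> a \<otimes>\<^bsub>C\<^esub> L g)"
    using R.E_gen[of "J +>\<^bsub>A\<^esub> a" g, unfolded system_quot_simps] q.q_closed[OF a] a g
    by (simp add: E_gen q.zero_quot)
qed

text \<open>The intertwining identity turns membership in J into vanishing of the quotient
  expectation on a positive element, to which faithfulness applies.\<close>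

lemma canonical_hom_eq_zero:
  assumes x: "x \<in> carrier C" and "E (star C x \<otimes>\<^bsub>C\<^esub> x) \<in> J"
  shows "\<pi> x = \<zero>\<^bsub>cp R\<^esub>"
proof (rule R.E_faithful)
  have "expt R (star (cp R) (\<pi> x) \<otimes>\<^bsub>cp R\<^esub> \<pi> x) = expt R (\<pi> (star C x \<otimes>\<^bsub>C\<^esub> x))"
    using x pi_hom(1,2,6) by simp
  then show "expt R (star (cp R) (\<pi> x) \<otimes>\<^bsub>cp R\<^esub> \<pi> x) = \<zero>\<^bsub>alg (system_quot S J)\<^esub>"
    using assms expt_canonical_hom[of "star C x \<otimes>\<^bsub>C\<^esub> x"] E(1)[of "star C x \<otimes>\<^bsub>C\<^esub> x"]
    by (simp add: q.q_eq_zero system_quot_simps)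
qed (use x pi_hom in simp)

text \<open>Injectivity of \<open>emb R\<close> shows that the kernel of \<pi> meets A exactly in J;
  with exactness this recovers J from its induced ideal.\<close>

lemma canonical_hom_emb_eq_zero:
  assumes a: "a \<in> carrier A" shows "\<pi> (\<iota> a) = \<zero>\<^bsub>cp R\<^esub> \<longleftrightarrow> a \<in> J"
proof -
  have "emb R \<zero>\<^bsub>cstar_quot A J\<^esub> = \<zero>\<^bsub>cp R\<^esub>"
    using star_hom_zero[OF R.emb_hom R.A.cstar_alg_axioms R.C.cstar_alg_axioms]
    by (simp add: system_quot_simps)
  then have "\<pi> (\<iota> a) = \<zero>\<^bsub>cp R\<^esub> \<longleftrightarrow> J +>\<^bsub>A\<^esub> a = \<zero>\<^bsub>cstar_quot A J\<^esub>"
    using pi(3)[OF a] q.q_closed[OF a] q.Q.zero_closed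
      reduced_crossed_product.emb_inj[OF R, unfolded system_quot_simps]
    by (metis inj_onD)
  then show ?thesis using q.q_eq_zero[OF a] by simp
qed

lemma canonical_hom_iso:
  "canonically_isomorphic_quotient S J P R (a_kernel C (cp R) \<pi>)"
proof -
  obtain \<phi> where \<phi>: "\<phi> \<in> star_iso (cstar_quot C (a_kernel C (cp R) \<pi>)) (cp R)"
    "\<forall>x\<in>carrier C. \<phi> (a_kernel C (cp R) \<pi> +>\<^bsub>C\<^esub> x) = \<pi> x"
    using star_hom_quotient_iso[OF pi(1,2) C.cstar_alg_axioms R.C.cstar_alg_axioms] by blast
  then show ?thesis
    unfolding canonically_isomorphic_quotient_def
    using pi(3,4) emb(1) uni(1) by (intro bexI[of _ \<phi>]) auto
qed

text \<open>Preimages of ideals contain the kernel, so maximality leaves only the kernel or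
  everything; surjectivity of \<pi> carries this back to M.\<close>

lemma simple_if_kernel_maximal:
  assumes max: "a_kernel C (cp R) \<pi> \<in> maximal_ideals C"
  shows "cstar_simple (cp R)"
  unfolding cstar_simple_def
proof (intro conjI allI impI)
  have "a_kernel C (cp R) \<pi> \<noteq> carrier C" using max by (simp add: maximal_ideals_def)
  then show "carrier (cp R) \<noteq> {\<zero>\<^bsub>cp R\<^esub>}" using pi_hom(1) by (auto simp: a_kernel_eq)
  fix M assume M: "closed_ideal M (cp R)"
  let ?V = "{x \<in> carrier C. \<pi> x \<in> M}"
  have V: "closed_ideal ?V C"
    by (rule closed_ideal_vimage[OF pi(1) C.cstar_alg_axioms R.C.cstar_alg_axioms M])
  have ker: "a_kernel C (cp R) \<pi> \<subseteq> ?V"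
    using closed_idealD(3)[OF M] by (auto simp: a_kernel_eq)
  have img: "M = \<pi> ` ?V"
  proof (intro equalityI subsetI)
    fix m assume m: "m \<in> M"
    then have "m \<in> \<pi> ` carrier C" unfolding pi(2) by (rule closed_idealD(2)[OF M])
    then show "m \<in> \<pi> ` ?V" using m by blast
  qed auto
  show "M = {\<zero>\<^bsub>cp R\<^esub>} \<or> M = carrier (cp R)"
  proof (cases "?V = carrier C")
    case True
    then show ?thesis using img pi(2) by simp
  next
    case False
    with max V ker have "?V = a_kernel C (cp R) \<pi>"
      unfolding maximal_ideals_def by simp
    with img have "M = \<pi> ` a_kernel C (cp R) \<pi>" by simp
    then have "M \<subseteq> {\<zero>\<^bsub>cp R\<^esub>}" by (auto simp: a_kernel_eq)
    then show ?thesis using closed_idealD(3)[OF M] by blast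
  qed
qed

end

end

text \<open>The inverse bijection sends a maximal ideal K to \<open>expectation_ideal K\<close>. The
  canonical homomorphisms themselves are obtained from \<open>exact_system\<close>, which asserts
  their existence along with the description of their kernels.\<close>

theorem theorem3p7:
  fixes S :: "('a, 'g) tsystem"
    and P :: "('a, 'g, 'b) crossed_product"
    and Q :: "'a set \<Rightarrow> ('a set, 'g, 'c) crossed_product"
  assumes "twisted_system S"
    and "reduced_crossed_product S P"
    and "\<And>J. invariant_ideal S J \<Longrightarrow> reduced_crossed_product (system_quot S J) (Q J)"
    and "exact_system S P Q"
    and "property_DP S P"
  shows "bij_betw (induced_ideal P) (maximal_invariant_ideals S) (maximal_ideals (cp P)) \<and>
    (\<forall>J \<in> maximal_invariant_ideals S. cstar_simple (cp (Q J)) \<and>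
      canonically_isomorphic_quotient S J P (Q J) (induced_ideal P J)) \<and>
    (\<forall>K. closed_ideal K (cp P) \<and> cstar_simple (cstar_quot (cp P) K) \<longrightarrow>
      (\<exists>J \<in> maximal_invariant_ideals S. canonically_isomorphic_quotient S J P (Q J) K))"
proof -
  interpret crossed S P by (rule crossed.intro) (rule assms(2))
  have emb_induced: "\<iota> ` J \<subseteq> induced_ideal P J" for J
    unfolding induced_ideal_def closed_genideal_def by blast
  have mono: "induced_ideal P J \<subseteq> induced_ideal P J'" if "J \<subseteq> J'" for J J'
    using that unfolding induced_ideal_def closed_genideal_def by blast
  have canonical: "\<exists>\<pi>. canonical_hom S J P (Q J) \<pi> \<and> induced_ideal P J = a_kernel C (cp (Q J)) \<pi>"
    if "invariant_ideal S J" for J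
    using assms(4) that by (simp add: exact_system_def canonical_kernel_def)
  have sub: "J \<subseteq> carrier A" if "invariant_ideal S J" for J
    using that closed_idealD(1)[of J A] by (simp add: invariant_ideal_def)
  have closed: "closed_ideal (induced_ideal P J) C" if "invariant_ideal S J" for J
    unfolding induced_ideal_def
    using emb(1) sub[OF that] by (intro C.closed_ideal_genideal) blast
  have emb_mem: "\<iota> a \<in> induced_ideal P J \<longleftrightarrow> a \<in> J" if J: "invariant_ideal S J" and a: "a \<in> carrier A" for J a
  proof -
    obtain \<pi> where \<pi>: "canonical_hom S J P (Q J) \<pi>" "induced_ideal P J = a_kernel C (cp (Q J)) \<pi>"
      using canonical[OF J] by blast
    then show ?thesis
      using canonical_hom_emb_eq_zero[OF J assms(3)[OF J] \<pi>(1) a] emb(1)[OF a] by (simp add: a_kernel_eq)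
  qed
  \<comment> \<open>Since J is the part of its induced ideal that lies in A, inclusions can be
    pulled back; this gives injectivity.\<close>
  have subset: "J \<subseteq> J'" if "invariant_ideal S J" "invariant_ideal S J'" "induced_ideal P J \<subseteq> induced_ideal P J'" for J J'
  proof
    fix a assume a: "a \<in> J"
    then have "a \<in> carrier A" using sub[OF that(1)] by blast
    then show "a \<in> J'" using emb_mem[OF that(1)] emb_mem[OF that(2)] a that(3) by blast
  qed
  have proper: "induced_ideal P J \<noteq> carrier C" if J: "invariant_ideal S J" "J \<noteq> carrier A" for J
  proof
    assume "induced_ideal P J = carrier C"
    then have "\<one>\<^bsub>A\<^esub> \<in> J" using emb_mem[OF J(1), of "\<one>\<^bsub>A\<^esub>"] emb(1)[of "\<one>\<^bsub>A\<^esub>"] by simp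
    then show False
      using A.closed_ideal_eq_carrier_if_one J by (simp add: invariant_ideal_def)
  qed
  have subset_induced: "K \<subseteq> induced_ideal P (expectation_ideal K)" if K: "closed_ideal K C" for K
  proof
    fix x assume x: "x \<in> K"
    let ?J = "expectation_ideal K"
    note J = invariant_expectation_ideal[OF K]
    obtain \<pi> where \<pi>: "canonical_hom S ?J P (Q ?J) \<pi>" "induced_ideal P ?J = a_kernel C (cp (Q ?J)) \<pi>"
      using canonical[OF J] by blast
    have xc: "x \<in> carrier C" using closed_idealD(2)[OF K x] .
    have "star C x \<otimes>\<^bsub>C\<^esub> x \<in> K" using closed_idealD(7)[OF K x] xc by simp
    then have "E (star C x \<otimes>\<^bsub>C\<^esub> x) \<in> ?J"
      using A.cl_subset[OF image_expt_carrier[OF K]] by (auto simp: expectation_ideal_def)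
    then show "x \<in> induced_ideal P ?J"
      using canonical_hom_eq_zero[OF J assms(3)[OF J] \<pi>(1) xc] xc by (simp add: \<pi>(2) a_kernel_eq)
  qed
  have subset_expectation: "J \<subseteq> expectation_ideal K"
    if J: "invariant_ideal S J" and K: "closed_ideal K C" "induced_ideal P J \<subseteq> K" for J K
  proof
    fix a assume a: "a \<in> J"
    then have "\<iota> a \<in> K" using emb_induced K(2) by blast
    moreover have "a \<in> carrier A" using a sub[OF J] by blast
    ultimately have "a \<in> E ` K" using E(6) by (metis imageI)
    then show "a \<in> expectation_ideal K"
      using A.cl_subset[OF image_expt_carrier[OF K(1)]] by (auto simp: expectation_ideal_def)
  qed
  note nontrivial = expectation_ideal_proper[OF _ assms(5)]
  have maximal: "induced_ideal P J \<in> maximal_ideals C" if J: "J \<in> maximal_invariant_ideals S" for J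
  proof -
    have inv: "invariant_ideal S J" "J \<noteq> carrier A"
      and max: "\<And>J'. \<lbrakk>invariant_ideal S J'; J' \<noteq> carrier A; J \<subseteq> J'\<rbrakk> \<Longrightarrow> J' = J"
      using J by (auto simp: maximal_invariant_ideals_def)
    have "K = induced_ideal P J" if K: "closed_ideal K C" "K \<noteq> carrier C" "induced_ideal P J \<subseteq> K" for K
    proof -
      \<comment> \<open>The expectation ideal of K is a proper invariant ideal above J, so
        maximality of J applies; \<open>subset_induced\<close> then bounds K from above.\<close>
      have "expectation_ideal K = J"
        using invariant_expectation_ideal[OF K(1)] nontrivial[OF K(1,2)]
          subset_expectation[OF inv(1) K(1,3)] by (rule max)
      then show ?thesis using subset_induced[OF K(1)] K(3) by auto
    qed
    then show ?thesis
      using closed[OF inv(1)] proper[OF inv] by (auto simp: maximal_ideals_def)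
  qed
  have surj: "\<exists>J\<in>maximal_invariant_ideals S. K = induced_ideal P J" if K: "K \<in> maximal_ideals C" for K
  proof -
    have K': "closed_ideal K C" "K \<noteq> carrier C"
      and max: "\<And>M. \<lbrakk>closed_ideal M C; M \<noteq> carrier C; K \<subseteq> M\<rbrakk> \<Longrightarrow> M = K"
      using K by (auto simp: maximal_ideals_def)
    let ?J = "expectation_ideal K"
    note J = invariant_expectation_ideal[OF K'(1)] nontrivial[OF K']
    have eq: "induced_ideal P ?J = K"
      using closed[OF J(1)] proper[OF J] subset_induced[OF K'(1)] by (rule max)
    \<comment> \<open>A proper J' above \<open>?J\<close> induces a proper ideal above K, hence K
      itself by maximality, and \<open>subset\<close> brings the equality back down to A.\<close>
    have "J' = ?J" if J': "invariant_ideal S J'" "J' \<noteq> carrier A" "?J \<subseteq> J'" for J'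
    proof -
      have "induced_ideal P J' = K"
        using closed[OF J'(1)] proper[OF J'(1,2)] mono[OF J'(3), unfolded eq] by (rule max)
      then show ?thesis using subset[OF J'(1) J(1)] eq J'(3) by auto
    qed
    then have "?J \<in> maximal_invariant_ideals S"
      using J by (auto simp: maximal_invariant_ideals_def)
    then show ?thesis using eq by blast
  qed
  have iso: "cstar_simple (cp (Q J)) \<and> canonically_isomorphic_quotient S J P (Q J) (induced_ideal P J)"
    if J: "J \<in> maximal_invariant_ideals S" for J
  proof -
    have inv: "invariant_ideal S J" using J by (simp add: maximal_invariant_ideals_def)
    obtain \<pi> where \<pi>: "canonical_hom S J P (Q J) \<pi>" "induced_ideal P J = a_kernel C (cp (Q J)) \<pi>"
      using canonical[OF inv] by blast
    show ?thesis
      using simple_if_kernel_maximal[OF inv assms(3)[OF inv] \<pi>(1)]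
        canonical_hom_iso[OF inv assms(3)[OF inv] \<pi>(1)] maximal[OF J] by (simp add: \<pi>(2))
  qed
  show ?thesis
  proof (intro conjI ballI allI impI)
    show "bij_betw (induced_ideal P) (maximal_invariant_ideals S) (maximal_ideals C)"
      unfolding bij_betw_def
    proof
      show "inj_on (induced_ideal P) (maximal_invariant_ideals S)"
        using subset by (intro inj_onI) (simp add: maximal_invariant_ideals_def subset_antisym)
      show "induced_ideal P ` maximal_invariant_ideals S = maximal_ideals C"
        using maximal surj by blast
    qed
    \<comment> \<open>Simplicity of the quotient makes K maximal, so K is an induced ideal and
      \<open>iso\<close> describes its quotient.\<close>
    fix K assume "closed_ideal K C \<and> cstar_simple (cstar_quot C K)"
    then have "K \<in> maximal_ideals C"
      by (intro cstar_quotient.maximal_if_simple_quot cstar_quotient.intro C.cstar_alg_axioms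
          cstar_quotient_axioms.intro) auto
    then show "\<exists>J\<in>maximal_invariant_ideals S. canonically_isomorphic_quotient S J P (Q J) K"
      using surj iso by blast
  qed (use iso in blast)+
qed

end
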